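(* For the Bounded Cost Minimum Diameter Edge Addition problem restricted to unit costs (with budget $B=k$), there exists a $(1,3k+2)$-approximation algorithm with running time $O(n^2+k^2)$, where $n$ is the number of vertices of the input graph.
   Context: Bounded Cost Minimum Diameter Edge Addition: input is an undirected graph $G=(V,E)$, a weight function $w:[V]^2\to\mathbb{N}$, a cost function $c:[V]^2\to\mathbb{N}^*$ (where $[V]^2$ is the set of unordered vertex pairs) and an integer $B$; the goal is a set $F$ of non-edges of $G$ with $\sum_{e\in F}c(e)\le B$ minimizing the diameter (largest shortest-path distance, path weight = sum of edge weights under $w$) of $(V,E\cup F)$; $D^B_{opt}$ denotes this minimum. In the unit-cost restriction $c\equiv1$, so one may add at most $k=B$ non-edges. An $(\alpha,\beta)$-approximation algorithm computes a set $F$ of non-edges of total cost at most $\alpha\cdot B$ such that the diameter of $(V,E\cup F)$ is at most $\beta\cdot D^B_{opt}$. *)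

theory Defs
  imports "HOL-Library.Ramsey" "Graph_Theory.Shortest_Path" "Graph_Theory.Pair_Digraph"
begin

section \<open>Bounded cost minimum diameter edge addition\<close>

text \<open>An undirected graph is given by a vertex set \<open>V\<close> and an edge set \<open>E \<subseteq> [V]\<^bsup>2\<^esup>\<close>. The functions
  \<open>w\<close> and \<open>c\<close> on unordered pairs are only ever used on \<open>[V]\<^bsup>2\<^esup>\<close>. Shortest-path distances are
  those of the symmetric digraph having both orientations of every edge as arcs.\<close>

definition sym_digraph_of :: "'v set \<Rightarrow> 'v set set \<Rightarrow> 'v pair_pre_digraph" where
  "sym_digraph_of V E = \<lparr> pverts = V, parcs = {(u, v). {u, v} \<in> E} \<rparr>"

definition sp_dist :: "'v set \<Rightarrow> 'v set set \<Rightarrow> ('v set \<Rightarrow> nat) \<Rightarrow> 'v \<Rightarrow> 'v \<Rightarrow> ereal" where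
  "sp_dist V E w u v =
     wf_digraph.\<mu> (with_proj (sym_digraph_of V E)) (\<lambda>(x, y). real (w {x, y})) u v"

text \<open>The value is \<open>\<infinity>\<close> if the graph is disconnected.\<close>

definition diameter :: "'v set \<Rightarrow> 'v set set \<Rightarrow> ('v set \<Rightarrow> nat) \<Rightarrow> ereal" where
  "diameter V E w = (SUP u\<in>V. SUP v\<in>V. sp_dist V E w u v)"

definition non_edges :: "'v set \<Rightarrow> 'v set set \<Rightarrow> 'v set set" where
  "non_edges V E = [V]\<^bsup>2\<^esup> - E"

definition opt_diameter ::
  "'v set \<Rightarrow> 'v set set \<Rightarrow> ('v set \<Rightarrow> nat) \<Rightarrow> ('v set \<Rightarrow> nat) \<Rightarrow> int \<Rightarrow> ereal" where
  "opt_diameter V E w c B =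
     (INF F\<in>{F. F \<subseteq> non_edges V E \<and> int (\<Sum>e\<in>F. c e) \<le> B}. diameter V (E \<union> F) w)"

definition approx_solution ::
  "real \<Rightarrow> real \<Rightarrow> 'v set \<Rightarrow> 'v set set \<Rightarrow> ('v set \<Rightarrow> nat) \<Rightarrow> ('v set \<Rightarrow> nat) \<Rightarrow> int \<Rightarrow>
     'v set set \<Rightarrow> bool" where
  "approx_solution \<alpha> \<beta> V E w c B F \<longleftrightarrow>
     F \<subseteq> non_edges V E \<and>
     real (\<Sum>e\<in>F. c e) \<le> \<alpha> * of_int B \<and>
     diameter V (E \<union> F) w \<le> ereal \<beta> * opt_diameter V E w c B"


section \<open>Random access machine with uniform cost\<close>

text \<open>Programs are structured random access machine programs. The memory consists of the arrays
  named in the program (finitely many, so they could be interleaved in a single memory with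
  constant overhead), each of unbounded length and with natural numbers as entries; a scalar
  variable is an array used at index \<open>0\<close> only. Every node of an expression and every command
  executed costs one time unit, irrespective of the size of the numbers. The only arithmetic is
  addition and truncated subtraction: with multiplication at unit cost the uniform cost measure
  would be unreasonably strong.\<close>

type_synonym state = "string \<Rightarrow> nat \<Rightarrow> nat"

datatype aexp = Const nat | Read string aexp | Add aexp aexp | Sub aexp aexp

datatype bexp = Less aexp aexp | Equal aexp aexp | Neg bexp | Conj bexp bexp

datatype com =
    Skip
  | Write string aexp aexp
  | Seq com com
  | Cond bexp com com
  | While bexp com

fun aval :: "aexp \<Rightarrow> state \<Rightarrow> nat" where
  "aval (Const m) s = m"
| "aval (Read x e) s = s x (aval e s)"
| "aval (Add e1 e2) s = aval e1 s + aval e2 s"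
| "aval (Sub e1 e2) s = aval e1 s - aval e2 s"

fun bval :: "bexp \<Rightarrow> state \<Rightarrow> bool" where
  "bval (Less e1 e2) s \<longleftrightarrow> aval e1 s < aval e2 s"
| "bval (Equal e1 e2) s \<longleftrightarrow> aval e1 s = aval e2 s"
| "bval (Neg b) s \<longleftrightarrow> \<not> bval b s"
| "bval (Conj b1 b2) s \<longleftrightarrow> bval b1 s \<and> bval b2 s"

fun acost :: "aexp \<Rightarrow> nat" where
  "acost (Const m) = 1"
| "acost (Read x e) = 1 + acost e"
| "acost (Add e1 e2) = 1 + acost e1 + acost e2"
| "acost (Sub e1 e2) = 1 + acost e1 + acost e2"

fun bcost :: "bexp \<Rightarrow> nat" where
  "bcost (Less e1 e2) = 1 + acost e1 + acost e2"
| "bcost (Equal e1 e2) = 1 + acost e1 + acost e2"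
| "bcost (Neg b) = 1 + bcost b"
| "bcost (Conj b1 b2) = 1 + bcost b1 + bcost b2"

text \<open>\<open>exec P s t s'\<close>: started in memory \<open>s\<close>, the program \<open>P\<close> terminates after exactly \<open>t\<close> time units
  with memory \<open>s'\<close>.\<close>

inductive exec :: "com \<Rightarrow> state \<Rightarrow> nat \<Rightarrow> state \<Rightarrow> bool" where
  exec_Skip: "exec Skip s 1 s"
| exec_Write:
    "exec (Write x i e) s (1 + acost i + acost e) (s(x := (s x)(aval i s := aval e s)))"
| exec_Seq:
    "exec P s t s' \<Longrightarrow> exec Q s' t' s'' \<Longrightarrow> exec (Seq P Q) s (1 + t + t') s''"
| exec_CondTrue:
    "bval b s \<Longrightarrow> exec P s t s' \<Longrightarrow> exec (Cond b P Q) s (1 + bcost b + t) s'"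
| exec_CondFalse:
    "\<not> bval b s \<Longrightarrow> exec Q s t s' \<Longrightarrow> exec (Cond b P Q) s (1 + bcost b + t) s'"
| exec_WhileFalse:
    "\<not> bval b s \<Longrightarrow> exec (While b P) s (1 + bcost b) s"
| exec_WhileTrue:
    "bval b s \<Longrightarrow> exec P s t s' \<Longrightarrow> exec (While b P) s' t' s'' \<Longrightarrow>
       exec (While b P) s (1 + bcost b + t + t') s''"

inductive_cases exec_SkipE: "exec Skip s t s'"
inductive_cases exec_WriteE: "exec (Write x i e) s t s'"
inductive_cases exec_SeqE: "exec (Seq P Q) s t s'"
inductive_cases exec_CondE: "exec (Cond b P Q) s t s'"
inductive_cases exec_WhileE: "exec (While b P) s t s'"

lemma exec_deterministic:
  assumes "exec P s t s'" and "exec P s u r"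
  shows "u = t \<and> r = s'"
  using assms
proof (induction arbitrary: u r rule: exec.induct)
  case (exec_Skip s)
  from exec_Skip.prems show ?case by (rule exec_SkipE) simp
next
  case (exec_Write x i e s)
  from exec_Write.prems show ?case by (rule exec_WriteE) simp
next
  case (exec_Seq P s t s' Q t' s'')
  from exec_Seq.prems obtain t1 s1 t2 where
    1: "exec P s t1 s1" and 2: "exec Q s1 t2 r" and u: "u = Suc (t1 + t2)" by (rule exec_SeqE)
  from exec_Seq.IH(1)[OF 1] have "t1 = t" "s1 = s'" by iprover+
  moreover from exec_Seq.IH(2)[OF 2[unfolded \<open>s1 = s'\<close>]] have "t2 = t'" "r = s''" by iprover+
  ultimately show ?case unfolding u by simp
next
  case (exec_CondTrue b s P t s' Q)
  from exec_CondTrue.prems obtain t1 where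
    1: "exec P s t1 r" and u: "u = Suc (bcost b + t1)" by (cases rule: exec_CondE) (use exec_CondTrue.hyps(1) in auto)
  from exec_CondTrue.IH[OF 1] show ?case unfolding u by simp
next
  case (exec_CondFalse b s Q t s' P)
  from exec_CondFalse.prems obtain t1 where
    1: "exec Q s t1 r" and u: "u = Suc (bcost b + t1)" by (cases rule: exec_CondE) (use exec_CondFalse.hyps(1) in auto)
  from exec_CondFalse.IH[OF 1] show ?case unfolding u by simp
next
  case (exec_WhileFalse b s P)
  from exec_WhileFalse.prems have "u = Suc (bcost b) \<and> r = s"
    by (cases rule: exec_WhileE) (use exec_WhileFalse.hyps(1) in auto)
  then show ?case by simp
next
  case (exec_WhileTrue b s P t s' t' s'')
  from exec_WhileTrue.prems obtain t1 s1 t2 where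
    1: "exec P s t1 s1" and 2: "exec (While b P) s1 t2 r"
    and u: "u = Suc (bcost b + t1 + t2)" by (cases rule: exec_WhileE) (use exec_WhileTrue.hyps(1) in auto)
  from exec_WhileTrue.IH(1)[OF 1] have "t1 = t" "s1 = s'" by iprover+
  moreover from exec_WhileTrue.IH(2)[OF 2[unfolded \<open>s1 = s'\<close>]] have "t2 = t'" "r = s''"
    by iprover+
  ultimately show ?case unfolding u by simp
qed


section \<open>Input and output conventions\<close>

text \<open>The vertices are \<open>0, \<dots>, n - 1\<close>. The input consists of \<open>n\<close>, \<open>k\<close>, and the adjacency matrix and
  the weight matrix, both stored row by row; all other memory cells are \<open>0\<close>.\<close>

definition initial_state :: "nat \<Rightarrow> nat set set \<Rightarrow> (nat set \<Rightarrow> nat) \<Rightarrow> nat \<Rightarrow> state" where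
  "initial_state n E w k = (\<lambda>x i.
     if x = ''n'' \<and> i = 0 then n
     else if x = ''k'' \<and> i = 0 then k
     else if x = ''adj'' \<and> i < n * n \<and> {i div n, i mod n} \<in> E then 1
     else if x = ''weight'' \<and> i < n * n \<and> i div n \<noteq> i mod n then w {i div n, i mod n}
     else 0)"

text \<open>The output is a list of pairs of vertices, its length being stored in \<open>''len''\<close>.\<close>

definition output_edges :: "state \<Rightarrow> nat set set" where
  "output_edges s = {{s ''src'' i, s ''tgt'' i} | i. i < s ''len'' 0}"

end

theory Submission
  imports Defs
begin

text \<open>Let \<open>D\<close> be the optimum, attained by \<open>F'\<close>. The edges of weight at most \<open>D\<close> of \<open>E \<union> F'\<close> connect
  all vertices, so the edges of weight at most \<open>D\<close> of \<open>E\<close> leave at most \<open>k + 1\<close> components. Without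
  knowing \<open>D\<close>, a minimum spanning forest of the input graph yields the least threshold \<open>thr \<le> D\<close> for
  which at most \<open>k + 1\<close> components remain, and a minimum spanning tree of the complete graph in which
  the edges of weight at most \<open>thr\<close> are free joins these components by at most \<open>k\<close> new edges; all
  its edges have weight at most \<open>D\<close>.

  For the diameter, cut a shortest-path tree of \<open>E \<union> F'\<close> at the edges of \<open>F'\<close>: this gives at most
  \<open>k + 1\<close> hubs such that every vertex has distance at most \<open>D\<close> to some hub already in \<open>E\<close>. A tree edge
  between vertices assigned to two different hubs shows that these hubs have distance at most
  \<open>3 D\<close>, so any two hubs have distance at most \<open>3 k D\<close> and any two vertices at most
  \<open>(3 k + 2) D\<close>.\<close>


section \<open>Walks\<close>

text \<open>The target \<open>r\<close> comes before the start \<open>v\<close>; \<open>c\<close> is the cost and \<open>l\<close> the number of edges.\<close>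

inductive walk :: "'v set set \<Rightarrow> ('v set \<Rightarrow> nat) \<Rightarrow> 'v \<Rightarrow> 'v \<Rightarrow> nat \<Rightarrow> nat \<Rightarrow> bool"
  for X w r where
  walk_refl: "walk X w r r 0 0"
| walk_step: "{v, x} \<in> X \<Longrightarrow> walk X w r x c l \<Longrightarrow> walk X w r v (w {v, x} + c) (Suc l)"

text \<open>Distances enter the combinatorics only as upper bounds in \<open>nat\<close>, so that no
  infimum in \<open>ereal\<close> has to be handled there. The start vertex comes first, unlike in
  \<open>walk\<close>.\<close>

definition within_dist :: "'v set set \<Rightarrow> ('v set \<Rightarrow> nat) \<Rightarrow> nat \<Rightarrow> 'v \<Rightarrow> 'v \<Rightarrow> bool" where
  "within_dist X w b u v \<longleftrightarrow> (\<exists>c l. walk X w v u c l \<and> c \<le> b)"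

lemma walk_trans:
  assumes "walk X w v u c l" and "walk X w r v c' l'"
  shows "walk X w r u (c + c') (l + l')"
  using assms(1)
proof induction
  case walk_refl
  then show ?case using assms(2) by simp
next
  case (walk_step a x c l)
  then show ?case by (metis walk.walk_step add.assoc add_Suc)
qed

lemma walk_edge: "{u, v} \<in> X \<Longrightarrow> walk X w v u (w {u, v}) 1"
  using walk_step[OF _ walk_refl] by fastforce

lemma walk_sym:
  assumes "walk X w v u c l"
  shows "walk X w u v c l"
  using assms
proof induction
  case walk_refl
  then show ?case by (rule walk.walk_refl)
next
  case (walk_step a x c l)
  have "walk X w a x (w {x, a}) 1"
    using walk_step.hyps by (intro walk_edge) (simp add: insert_commute)
  with walk_step.IH have "walk X w a v (c + w {x, a}) (l + 1)" by (rule walk_trans)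
  then show ?case by (simp add: insert_commute add.commute)
qed

lemma walk_mono:
  assumes "walk X w v u c l" and "X \<subseteq> Y"
  shows "walk Y w v u c l"
  using assms by (induction) (auto intro: walk.intros)

lemma within_dist_refl: "within_dist X w b u u"
  unfolding within_dist_def by (intro exI conjI, rule walk_refl) simp

lemma within_dist_edge: "{u, v} \<in> X \<Longrightarrow> w {u, v} \<le> b \<Longrightarrow> within_dist X w b u v"
  unfolding within_dist_def by (intro exI conjI, rule walk_edge)

lemma within_dist_sym: "within_dist X w b u v \<Longrightarrow> within_dist X w b v u"
  unfolding within_dist_def by (elim exE conjE, intro exI conjI, erule walk_sym)

lemma within_dist_trans:
  "within_dist X w b u v \<Longrightarrow> within_dist X w b' v x \<Longrightarrow> within_dist X w (b + b') u x"
  unfolding within_dist_def using walk_trans add_mono by metis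

lemma within_dist_mono:
  "within_dist X w b u v \<Longrightarrow> X \<subseteq> Y \<Longrightarrow> b \<le> b' \<Longrightarrow> within_dist Y w b' u v"
  unfolding within_dist_def by (blast intro: walk_mono order_trans)

section \<open>Walks versus shortest-path distances in the digraph\<close>

lemma sym_digraph_of_simps [simp]:
  "pverts (sym_digraph_of V X) = V"
  "(u, v) \<in> parcs (sym_digraph_of V X) \<longleftrightarrow> {u, v} \<in> X"
  by (simp_all add: sym_digraph_of_def)

lemma wf_digraph_sym_digraph_of:
  assumes "X \<subseteq> [V]\<^bsup>2\<^esup>"
  shows "wf_digraph (with_proj (sym_digraph_of V X))"
  using assms by unfold_locales auto

lemma awalk_imp_walk:
  assumes "X \<subseteq> [V]\<^bsup>2\<^esup>" and "pre_digraph.awalk (with_proj (sym_digraph_of V X)) u p v"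
  shows "\<exists>c. walk X w v u c (length p) \<and>
    wf_digraph.awalk_cost (\<lambda>(x, y). real (w {x, y})) p = real c"
proof -
  interpret wf_digraph "with_proj (sym_digraph_of V X)"
    using assms(1) by (rule wf_digraph_sym_digraph_of)
  show ?thesis
    using assms(2)
  proof (induction p arbitrary: u)
    case Nil
    then show ?case by (auto simp: awalk_Nil_iff intro: walk_refl)
  next
    case (Cons e p)
    obtain a x where e: "e = (a, x)" by (cases e)
    from Cons.prems have a: "a = u" "{u, x} \<in> X" "awalk x p v"
      unfolding e by (auto simp: awalk_Cons_iff)
    from Cons.IH[OF a(3)] obtain c where
      "walk X w v x c (length p)" "awalk_cost (\<lambda>(x, y). real (w {x, y})) p = real c" by blast
    then show ?case
      using walk_step[OF a(2), of w v c "length p"] a(1) e by (intro exI[of _ "w {u, x} + c"]) simp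
  qed
qed

lemma walk_imp_awalk:
  assumes "X \<subseteq> [V]\<^bsup>2\<^esup>" and "walk X w v u c l" and "v \<in> V"
  shows "\<exists>p. pre_digraph.awalk (with_proj (sym_digraph_of V X)) u p v \<and>
    wf_digraph.awalk_cost (\<lambda>(x, y). real (w {x, y})) p = real c"
proof -
  interpret wf_digraph "with_proj (sym_digraph_of V X)"
    using assms(1) by (rule wf_digraph_sym_digraph_of)
  show ?thesis
    using assms(2)
  proof induction
    case walk_refl
    have "awalk v [] v" using assms(3) by (simp add: awalk_Nil_iff)
    then show ?case by (intro exI[of _ "[]"]) simp
  next
    case (walk_step u x c l)
    then obtain p where
      p: "awalk x p v" "awalk_cost (\<lambda>(x, y). real (w {x, y})) p = real c" by blast
    have "awalk u ((u, x) # p) v"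
      using p(1) walk_step.hyps by (simp add: awalk_Cons_iff)
    then show ?case using p(2) by (intro exI[of _ "(u, x) # p"]) simp
  qed
qed

text \<open>Walk costs are integers, so a real bound on the distance may be rounded down and is then
  met by an actual walk.\<close>

lemma within_dist_floor:
  assumes "X \<subseteq> [V]\<^bsup>2\<^esup>" and "sp_dist V X w u v \<le> ereal r"
  shows "within_dist X w (nat \<lfloor>r\<rfloor>) u v"
proof (rule ccontr)
  assume not_within: "\<not> within_dist X w (nat \<lfloor>r\<rfloor>) u v"
  interpret wf_digraph "with_proj (sym_digraph_of V X)"
    using assms(1) by (rule wf_digraph_sym_digraph_of)
  \<comment> \<open>Without a walk of cost at most \<open>nat \<lfloor>r\<rfloor>\<close>, all walks
    cost at least one more, and so does their infimum, which then exceeds \<open>r\<close>. If there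
    is no walk at all the infimum is infinite.\<close>
  have "ereal (real (Suc (nat \<lfloor>r\<rfloor>))) \<le> sp_dist V X w u v"
    unfolding sp_dist_def \<mu>_def
  proof (rule INF_greatest)
    fix p assume "p \<in> {p. awalk u p v}"
    then obtain c where c: "walk X w v u c (length p)"
      "awalk_cost (\<lambda>(x, y). real (w {x, y})) p = real c"
      using awalk_imp_walk[OF assms(1)] by blast
    have "Suc (nat \<lfloor>r\<rfloor>) \<le> c" using not_within c(1) unfolding within_dist_def by force
    then show "ereal (real (Suc (nat \<lfloor>r\<rfloor>))) \<le> ereal (awalk_cost (\<lambda>(x, y). real (w {x, y})) p)"
      unfolding c(2) by simp
  qed
  also note assms(2)
  finally show False by simp linarith
qed

lemma sp_dist_le:
  assumes "X \<subseteq> [V]\<^bsup>2\<^esup>" and "v \<in> V" and "within_dist X w b u v"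
  shows "sp_dist V X w u v \<le> ereal (real b)"
proof -
  interpret wf_digraph "with_proj (sym_digraph_of V X)"
    using assms(1) by (rule wf_digraph_sym_digraph_of)
  from assms(3) obtain c l where "walk X w v u c l" and c: "c \<le> b"
    unfolding within_dist_def by blast
  then obtain p where "awalk u p v" "awalk_cost (\<lambda>(x, y). real (w {x, y})) p = real c"
    using walk_imp_awalk[OF assms(1) _ assms(2)] by blast
  then have "sp_dist V X w u v \<le> ereal (real c)"
    unfolding sp_dist_def using min_cost_le_walk_cost[of u p v "\<lambda>(x, y). real (w {x, y})"] by simp
  also have "\<dots> \<le> ereal (real b)" using c by simp
  finally show ?thesis .
qed


section \<open>Hubs\<close>

text \<open>Every vertex but the root has a successor on a shortest walk to the root; choosing shortest
  walks with as few edges as possible makes the successor relation well-founded in spite of edges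
  of weight \<open>0\<close>. The hubs are the root and the vertices that leave along an edge of \<open>F\<close>.\<close>

lemma hubs:
  fixes V :: "'v set"
  assumes "finite V" and F: "finite F" and X: "X \<union> F \<subseteq> [V]\<^bsup>2\<^esup>" and r: "r \<in> V"
    and radius: "\<And>v. v \<in> V \<Longrightarrow> within_dist (X \<union> F) w b v r"
  shows "\<exists>R\<subseteq>V. card R \<le> Suc (card F) \<and> (\<forall>v\<in>V. \<exists>x\<in>R. within_dist X w b v x)"
proof -
  define wl where "wl = walk (X \<union> F) w r"
  define dist where "dist v = (LEAST c. \<exists>l. wl v c l)" for v
  \<comment> \<open>Edges of weight \<open>0\<close> leave \<open>dist\<close> unchanged; counting
    the edges of cheapest walks breaks such ties.\<close>
  define len where "len v = (LEAST l. wl v (dist v) l)" for v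
  have ex: "\<exists>c l. wl v c l" if "v \<in> V" for v
    using radius[OF that] unfolding within_dist_def wl_def by blast
  have dist_le: "dist v \<le> c" if "wl v c l" for v c l
    unfolding dist_def using that by (intro Least_le) blast
  have wl_dist: "wl v (dist v) (len v)" if "v \<in> V" for v
    unfolding len_def dist_def using LeastI_ex[OF ex[OF that]] by (rule LeastI_ex)
  have dist_b: "dist v \<le> b" if "v \<in> V" for v
    using radius[OF that] dist_le order_trans unfolding within_dist_def wl_def by blast
  \<comment> \<open>The first step of a cheapest walk with fewest edges leads to a vertex that is
    nearer to \<open>r\<close>, or equally near with fewer edges to go. So \<open>measures\<close>
    decreases lexicographically.\<close>
  have "\<exists>x. x \<in> V \<and> {v, x} \<in> X \<union> F \<and> w {v, x} + dist x \<le> dist v \<and>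
      ((x, v) \<in> measures [dist, len])" if v: "v \<in> V" "v \<noteq> r" for v
  proof -
    have "walk (X \<union> F) w r v (dist v) (len v)" using wl_dist[OF v(1)] unfolding wl_def .
    then show ?thesis
    proof cases
      case walk_refl
      then show ?thesis using v(2) by simp
    next
      case (walk_step x c l)
      have x: "x \<in> V" using walk_step(3) X by (auto simp: subset_iff)
      have c: "dist x \<le> c" using dist_le walk_step(4) unfolding wl_def by blast
      moreover have "len x \<le> l" if "dist x = c"
        using walk_step(4) that unfolding len_def wl_def by (auto intro: Least_le)
      ultimately show ?thesis using walk_step(1-3) x by (intro exI[of _ x]) auto
    qed
  qed
  then obtain p where p: "\<And>v. v \<in> V \<Longrightarrow> v \<noteq> r \<Longrightarrow> p v \<in> V \<and> {v, p v} \<in> X \<union> F \<and>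
      w {v, p v} + dist (p v) \<le> dist v \<and> (p v, v) \<in> measures [dist, len]" by metis
  define R where "R = insert r {v \<in> V - {r}. {v, p v} \<in> F}"
  \<comment> \<open>Each hub other than the root is charged to the edge of \<open>F\<close> along
    which it leaves. Two hubs sharing that edge would be successors of each other, which the
    decreasing measure forbids.\<close>
  have "card {v \<in> V - {r}. {v, p v} \<in> F} \<le> card F"
  proof (rule card_inj_on_le[of "\<lambda>v. {v, p v}"])
    show "inj_on (\<lambda>v. {v, p v}) {v \<in> V - {r}. {v, p v} \<in> F}"
    proof (rule inj_onI, rule ccontr)
      fix u v
      assume u: "u \<in> {v \<in> V - {r}. {v, p v} \<in> F}" and v: "v \<in> {v \<in> V - {r}. {v, p v} \<in> F}"
        and eq: "{u, p u} = {v, p v}" and "u \<noteq> v"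
      then have "p u = v" "p v = u" by (auto simp: doubleton_eq_iff)
      then show False using p[of u] p[of v] u v by auto
    qed
  qed (use F in auto)
  then have "card R \<le> Suc (card F)"
    unfolding R_def using assms(1) by (simp add: card_insert_if)
  \<comment> \<open>With \<open>dist v\<close> in place of \<open>b\<close> the induction along
    successors closes: each edge pays for itself. The route stops at the first hub, hence before any
    edge of \<open>F\<close>.\<close>
  moreover have "\<forall>v\<in>V. \<exists>x\<in>R. within_dist X w (dist v) v x"
  proof
    fix v assume "v \<in> V"
    then show "\<exists>x\<in>R. within_dist X w (dist v) v x"
    proof (induction v rule: wf_induct_rule[OF wf_measures, of "[dist, len]"])
      case (1 v)
      show ?case
      proof (cases "v \<in> R")
        case True
        then show ?thesis by (intro bexI[of _ v] within_dist_refl)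
      next
        case False
        then have v: "v \<noteq> r" "{v, p v} \<notin> F" using 1(2) unfolding R_def by auto
        note pv = p[OF 1(2) v(1)]
        obtain x where x: "x \<in> R" "within_dist X w (dist (p v)) (p v) x" using 1 pv by blast
        have "within_dist X w (w {v, p v}) v (p v)"
          using pv v(2) by (intro within_dist_edge) auto
        from within_dist_mono[OF within_dist_trans[OF this x(2)] subset_refl]
        show ?thesis using pv x(1) by blast
      qed
  qed
  qed
  then have "\<exists>x\<in>R. within_dist X w b v x" if "v \<in> V" for v
    using that by (elim ballE bexE) (auto intro: within_dist_mono[OF _ subset_refl dist_b])
  moreover have "R \<subseteq> V" using r unfolding R_def by blast
  ultimately show ?thesis by blast
qed


section \<open>Connected components\<close>

text \<open>The equivalence closure on the whole type, so that \<open>V // conn r\<close> consists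
  of the components that meet \<open>V\<close>.\<close>

definition conn :: "('a \<times> 'a) set \<Rightarrow> ('a \<times> 'a) set" where
  "conn r = (r \<union> r\<inverse>)\<^sup>*"

lemma conn_refl [simp]: "(x, x) \<in> conn r"
  by (simp add: conn_def)

lemma conn_sym: "(x, y) \<in> conn r \<Longrightarrow> (y, x) \<in> conn r"
  unfolding conn_def by (metis converse_Un converse_converse rtrancl_converseI sup_commute)

lemma conn_trans: "(x, y) \<in> conn r \<Longrightarrow> (y, z) \<in> conn r \<Longrightarrow> (x, z) \<in> conn r"
  unfolding conn_def by (rule rtrancl_trans)

lemma conn_base: "(x, y) \<in> r \<Longrightarrow> (x, y) \<in> conn r"
  unfolding conn_def by blast

lemma conn_least:
  assumes "r \<subseteq> conn s"
  shows "conn r \<subseteq> conn s"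
proof -
  have "r \<union> r\<inverse> \<subseteq> conn s" using assms conn_sym by fastforce
  then show ?thesis using rtrancl_subset_rtrancl unfolding conn_def by blast
qed

lemma conn_mono: "r \<subseteq> s \<Longrightarrow> conn r \<subseteq> conn s"
  by (intro conn_least) (auto intro: conn_base)

lemma equiv_conn: "equiv UNIV (conn r)"
  by (intro equivI refl_onI symI transI) (auto intro: conn_sym conn_trans)

text \<open>Repeated crossings of the new pair can be cut out, so one crossing, in one of the two
  directions, suffices.\<close>

lemma conn_insert:
  assumes "(x, y) \<in> conn (insert (a, b) r)"
  shows "(x, y) \<in> conn r \<or> (x, a) \<in> conn r \<and> (b, y) \<in> conn r \<or> (x, b) \<in> conn r \<and> (a, y) \<in> conn r"
  using assms unfolding conn_def
proof (induction rule: rtrancl_induct)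
  case base
  then show ?case by simp
next
  case (step y z)
  then have "(y, z) \<in> conn r \<or> y = a \<and> z = b \<or> y = b \<and> z = a"
    by (auto intro: conn_base conn_sym)
  with step.IH[folded conn_def] show ?case
    by (fold conn_def) (metis conn_refl conn_trans)
qed

text \<open>Only the class of \<open>a\<close> can be absorbed: two different old classes that
  become one are those of \<open>a\<close> and \<open>b\<close>. Hence passing to the new classes is
  injective once the class of \<open>a\<close> is left out.\<close>

lemma card_components_insert:
  assumes "finite V"
  shows "card (V // conn r) \<le> Suc (card (V // conn (insert (a, b) r)))"
proof -
  let ?s = "insert (a, b) r"
  have rs: "conn r \<subseteq> conn ?s" by (intro conn_mono) auto
  have eq: "C = D" if C: "C \<in> V // conn r - {conn r `` {a}}" and D: "D \<in> V // conn r - {conn r `` {a}}"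
    and CD: "conn ?s `` C = conn ?s `` D" for C D
  proof -
    from C obtain u where u: "u \<in> V" "C = conn r `` {u}" by (auto elim!: quotientE)
    from D obtain v where v: "v \<in> V" "D = conn r `` {v}" by (auto elim!: quotientE)
    have "u \<in> conn ?s `` D" using CD u by (metis ImageI conn_refl singletonI)
    then obtain v' where "(v, v') \<in> conn r" "(v', u) \<in> conn ?s" using v by blast
    then have "(v, u) \<in> conn ?s" using rs conn_trans[of v v' ?s u] by blast
    moreover have "(u, a) \<notin> conn r"
      using C u(2) by (auto dest: equiv_class_eq[OF equiv_conn])
    moreover have "(v, a) \<notin> conn r"
      using D v(2) by (auto dest: equiv_class_eq[OF equiv_conn])
    ultimately have "(v, u) \<in> conn r"
      using conn_insert[of v u a b r] conn_sym[of v b r] conn_sym[of a u r] conn_sym[of b u r]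
        conn_sym[of v a r] conn_sym[of u a r] conn_sym[of a v r] by argo
    then show "C = D" using equiv_class_eq[OF equiv_conn] u v by metis
  qed
  have "card (V // conn r - {conn r `` {a}}) \<le> card (V // conn ?s)"
  proof (rule card_inj_on_le[of "\<lambda>C. conn ?s `` C"])
    show "inj_on (\<lambda>C. conn ?s `` C) (V // conn r - {conn r `` {a}})" using eq by (rule inj_onI)
    show "(\<lambda>C. conn ?s `` C) ` (V // conn r - {conn r `` {a}}) \<subseteq> V // conn ?s"
    proof (rule image_subsetI)
      fix C assume "C \<in> V // conn r - {conn r `` {a}}"
      then obtain u where "u \<in> V" and C: "C = conn r `` {u}" by (auto elim: quotientE)
      moreover have "conn ?s `` (conn r `` {u}) = conn ?s `` {u}"
        using rs conn_trans conn_refl by (fastforce simp: Image_iff)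
      ultimately show "conn ?s `` C \<in> V // conn ?s" by (simp add: quotientI)
    qed
    show "finite (V // conn ?s)" using assms by (simp add: quotient_def)
  qed
  then show ?thesis using card_Diff1_le by (simp add: card_Diff_singleton_if split: if_splits)
qed

lemma card_components_union:
  assumes "finite V" and "finite s"
  shows "card (V // conn r) \<le> card (V // conn (r \<union> s)) + card s"
  using assms(2)
proof induction
  case empty
  then show ?case by simp
next
  case (insert e s)
  have "card (V // conn (r \<union> s)) \<le> Suc (card (V // conn (r \<union> insert e s)))"
    using card_components_insert[OF assms(1), of "r \<union> s" "fst e" "snd e"] by simp
  then show ?case using insert by simp
qed

lemma components_discrete: "card (V // conn {}) = card V"
proof -
  have "conn {} = (Id :: ('a \<times> 'a) set)" by (simp add: conn_def)
  then have "V // conn {} = (\<lambda>x. {x}) ` V" by (auto simp: quotient_def)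
  then show ?thesis by (simp add: card_image)
qed

lemma components_connected:
  assumes "\<And>u v. u \<in> V \<Longrightarrow> v \<in> V \<Longrightarrow> (u, v) \<in> conn r"
  shows "card (V // conn r) \<le> 1"
proof (cases "V = {}")
  case False
  then obtain u where "u \<in> V" by blast
  have "C = conn r `` {u}" if "C \<in> V // conn r" for C
    using that \<open>u \<in> V\<close> assms equiv_class_eq[OF equiv_conn] by (metis quotientE)
  then have "V // conn r \<subseteq> {conn r `` {u}}" by blast
  then show ?thesis using card_mono[of "{conn r `` {u}}"] by simp
qed simp

text \<open>As weights are nonnegative, no edge of a walk weighs more than the whole walk.\<close>

lemma within_dist_conn:
  assumes "within_dist X w b u v"
  shows "(u, v) \<in> conn {(x, y). {x, y} \<in> X \<and> w {x, y} \<le> b}"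
proof -
  from assms obtain c l where "walk X w v u c l" "c \<le> b" unfolding within_dist_def by blast
  then show ?thesis
  proof induction
    case (walk_step x y c l)
    then have "(x, y) \<in> conn {(x, y). {x, y} \<in> X \<and> w {x, y} \<le> b}" by (intro conn_base) simp
    then show ?case using walk_step by (auto intro: conn_trans[of x y])
  qed simp
qed


section \<open>Diameter of a hub graph\<close>

text \<open>A shortest path with \<open>m\<close> steps visits \<open>m + 1\<close> distinct
  elements of \<open>A\<close>.\<close>

lemma rtrancl_imp_relpow_less_card:
  assumes "finite A" and "r \<subseteq> A \<times> A" and "a \<in> A" and "(a, b) \<in> r\<^sup>*"
  shows "\<exists>m < card A. (a, b) \<in> r ^^ m"
proof -
  define m where "m = (LEAST m. (a, b) \<in> r ^^ m)"
  have m: "(a, b) \<in> r ^^ m"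
    unfolding m_def by (rule LeastI_ex) (use assms(4) in \<open>simp add: rtrancl_power\<close>)
  then have "\<exists>f. f 0 = a \<and> f m = b \<and> (\<forall>i<m. (f i, f (Suc i)) \<in> r)"
    by (simp only: relpow_fun_conv)
  then obtain f where f: "f 0 = a" "f m = b" "\<forall>i<m. (f i, f (Suc i)) \<in> r" by (elim exE conjE)
  \<comment> \<open>Cutting out the loop between two equal positions would give a shorter
    path.\<close>
  have ne: "f i \<noteq> f j" if ij: "i < j" "j \<le> m" for i j
  proof
    assume eq: "f i = f j"
    have "(a, f i) \<in> r ^^ i"
      unfolding relpow_fun_conv using f ij by (intro exI[of _ f]) auto
    moreover have "(f i, b) \<in> r ^^ (m - j)"
      unfolding relpow_fun_conv using f ij eq by (intro exI[of _ "\<lambda>l. f (l + j)"]) auto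
    ultimately have "(a, b) \<in> r ^^ (i + (m - j))" by (rule relpow_trans)
    then have "m \<le> i + (m - j)" unfolding m_def by (rule Least_le)
    then show False using ij by simp
  qed
  have "inj_on f {..m}" by (rule inj_onI) (metis ne atMost_iff linorder_neqE_nat)
  moreover have "f ` {..m} \<subseteq> A"
  proof clarify
    fix i assume "i \<le> m"
    then show "f i \<in> A" using f assms(2,3) by (cases i) (auto simp: Suc_le_eq)
  qed
  ultimately have "card {..m} \<le> card A" using assms(1) by (intro card_inj_on_le)
  then show ?thesis using m by (intro exI[of _ m]) simp
qed

text \<open>Contracting every vertex to its hub turns \<open>L\<close> into a relation on
  \<open>R\<close>. A contracted link costs at most \<open>3 * b\<close>, a path in \<open>R\<close>
  needs at most \<open>k\<close> of them, and both ends add \<open>b\<close> to reach their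
  hubs.\<close>

lemma hub_diameter:
  assumes R: "finite R" "card R \<le> Suc k" and hub: "\<And>v. v \<in> V \<Longrightarrow> \<exists>x\<in>R. within_dist H w b v x"
    and L: "\<And>x y. (x, y) \<in> L \<Longrightarrow> x \<in> V \<and> y \<in> V \<and> {x, y} \<in> H \<and> w {x, y} \<le> b"
    and uv: "u \<in> V" "v \<in> V" "(u, v) \<in> conn L"
  shows "within_dist H w ((3 * k + 2) * b) u v"
proof -
  obtain f where f: "\<And>v. v \<in> V \<Longrightarrow> f v \<in> R \<and> within_dist H w b v (f v)" using hub by metis
  define r where "r = (\<lambda>(x, y). (f x, f y)) ` (L \<union> L\<inverse>)"
  have step: "x \<in> R \<and> y \<in> R \<and> within_dist H w (3 * b) x y" if "(x, y) \<in> r" for x y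
  proof -
    from that obtain x' y' where xy: "(x', y') \<in> L \<union> L\<inverse>" "x = f x'" "y = f y'"
      unfolding r_def by auto
    then have V: "x' \<in> V" "y' \<in> V" and e: "{x', y'} \<in> H" "w {x', y'} \<le> b"
      using L[of x' y'] L[of y' x'] by (auto simp: insert_commute)
    \<comment> \<open>The three legs are hub to vertex, the link itself, and vertex to hub.\<close>
    have "within_dist H w (b + b + b) x y"
      unfolding xy(2,3) using f V within_dist_edge[of _ _ _ w, OF e]
      by (intro within_dist_trans[where v = y'] within_dist_trans[where v = x'])
        (auto intro: within_dist_sym)
    moreover have "b + b + b = 3 * b" by simp
    ultimately show ?thesis using f V xy by simp
  qed
  have "(f u, f v) \<in> r\<^sup>*"
    using uv(3) unfolding conn_def
  proof induction
    case (step y z)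
    then have "(f y, f z) \<in> r" unfolding r_def by force
    then show ?case using step.IH by simp
  qed simp
  moreover have "r \<subseteq> R \<times> R" using step by auto
  ultimately obtain m where m: "m < card R" "(f u, f v) \<in> r ^^ m"
    using rtrancl_imp_relpow_less_card[OF R(1), of r "f u" "f v"] f uv by auto
  have "within_dist H w (3 * m * b) x y" if "(x, y) \<in> r ^^ m" for x y m
    using that
  proof (induction m arbitrary: y)
    case 0
    then show ?case by (simp add: within_dist_refl)
  next
    case (Suc m)
    then obtain z where "within_dist H w (3 * m * b) x z" "within_dist H w (3 * b) z y"
      using step by auto
    from within_dist_trans[OF this] show ?case by (simp add: algebra_simps)
  qed
  then have "within_dist H w (b + 3 * m * b + b) u v"
    using m f uv by (intro within_dist_trans[where v = "f v"] within_dist_trans[where v = "f u"])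
      (auto intro: within_dist_sym)
  moreover have "3 * m * b \<le> 3 * k * b" using m(1) R(2) by simp
  ultimately show ?thesis
    by (elim within_dist_mono) (auto simp: algebra_simps)
qed


section \<open>Prim's algorithm\<close>

definition light :: "nat \<Rightarrow> (nat \<Rightarrow> nat \<Rightarrow> nat) \<Rightarrow> nat \<Rightarrow> (nat \<times> nat) set" where
  "light n C d = {(u, v). u < n \<and> v < n \<and> u \<noteq> v \<and> C u v \<le> d}"

text \<open>The tree edges of cost at most \<open>d\<close>, each named by its lower end; the root
  \<open>0\<close> has a key but no parent edge.\<close>

definition tree_links :: "nat set \<Rightarrow> (nat \<Rightarrow> nat) \<Rightarrow> (nat \<Rightarrow> nat) \<Rightarrow> nat \<Rightarrow> (nat \<times> nat) set" where
  "tree_links S key par d = (\<lambda>j. (j, par j)) ` {j \<in> S. 0 < j \<and> key j \<le> d}"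

text \<open>The last clause makes the invariant inductive: the vertices of \<open>S\<close> from which an edge of
  cost at most \<open>d\<close> leaves \<open>S\<close> all lie in one component of the tree edges of cost at most \<open>d\<close>.\<close>

definition prim_tree ::
  "nat \<Rightarrow> (nat \<Rightarrow> nat \<Rightarrow> nat) \<Rightarrow> nat set \<Rightarrow> (nat \<Rightarrow> nat) \<Rightarrow> (nat \<Rightarrow> nat) \<Rightarrow> bool" where
  "prim_tree n C S key par \<longleftrightarrow>
     0 \<in> S \<and> S \<subseteq> {..<n} \<and> key 0 = 0 \<and>
     (\<forall>j<n. 0 < j \<longrightarrow> par j \<in> S \<and> par j \<noteq> j \<and> key j = C j (par j)) \<and>
     (\<forall>j<n. j \<notin> S \<longrightarrow> (\<forall>u\<in>S. key j \<le> C j u)) \<and>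
     (\<forall>u\<in>S. \<forall>v\<in>S. \<forall>d. u \<noteq> v \<longrightarrow> C u v \<le> d \<longrightarrow> (u, v) \<in> conn (tree_links S key par d)) \<and>
     (\<forall>u\<in>S. \<forall>v\<in>S. \<forall>x<n. \<forall>y<n. \<forall>d. x \<notin> S \<longrightarrow> y \<notin> S \<longrightarrow> C u x \<le> d \<longrightarrow> C v y \<le> d \<longrightarrow>
        (u, v) \<in> conn (tree_links S key par d))"

lemma prim_tree_init:
  assumes "0 < n" and "key 0 = 0" and "\<And>j. 0 < j \<Longrightarrow> j < n \<Longrightarrow> par j = 0 \<and> key j = C j 0"
  shows "prim_tree n C {0} key par"
  using assms unfolding prim_tree_def by auto

text \<open>All thresholds \<open>d\<close> are treated at once. The core is \<open>exit\<close>: a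
  vertex of \<open>S\<close> with an edge of cost at most \<open>d\<close> leaving \<open>S\<close>
  is joined to \<open>u\<close> by tree edges of cost at most \<open>d\<close>.\<close>

lemma prim_tree_step:
  assumes inv: "prim_tree n C S key par"
    and sym: "\<And>u v. u < n \<Longrightarrow> v < n \<Longrightarrow> u \<noteq> v \<Longrightarrow> C u v = C v u"
    and u: "u < n" "u \<notin> S" and minimal: "\<And>j. j < n \<Longrightarrow> j \<notin> S \<Longrightarrow> key u \<le> key j"
    and key': "\<And>j. j < n \<Longrightarrow>
      key' j = (if j \<notin> insert u S \<and> C u j < key j then C u j else key j)"
    and par': "\<And>j. j < n \<Longrightarrow>
      par' j = (if j \<notin> insert u S \<and> C u j < key j then u else par j)"
  shows "prim_tree n C (insert u S) key' par'"
proof -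
  have S: "0 \<in> S" "S \<subseteq> {..<n}" "key 0 = 0"
    and tree: "\<And>j. j < n \<Longrightarrow> 0 < j \<Longrightarrow> par j \<in> S \<and> par j \<noteq> j \<and> key j = C j (par j)"
    and key_le: "\<And>j v. j < n \<Longrightarrow> j \<notin> S \<Longrightarrow> v \<in> S \<Longrightarrow> key j \<le> C j v"
    using inv unfolding prim_tree_def by simp_all
  have spans: "\<And>v x d. v \<in> S \<Longrightarrow> x \<in> S \<Longrightarrow> v \<noteq> x \<Longrightarrow> C v x \<le> d \<Longrightarrow>
      (v, x) \<in> conn (tree_links S key par d)"
    and boundary: "\<forall>v\<in>S. \<forall>v'\<in>S. \<forall>x<n. \<forall>y<n. \<forall>d. x \<notin> S \<longrightarrow> y \<notin> S \<longrightarrow>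
      C v x \<le> d \<longrightarrow> C v' y \<le> d \<longrightarrow> (v, v') \<in> conn (tree_links S key par d)"
    using inv unfolding prim_tree_def by simp_all
  have u0: "0 < u" using u S by (metis gr0I)
  define L where "L = tree_links (insert u S) key' par'"
  \<comment> \<open>Keys and parents of visited vertices are frozen, so old tree edges
    survive.\<close>
  have L: "tree_links S key par d \<subseteq> L d" for d
    using S(2) key' par' unfolding L_def tree_links_def by (fastforce simp: image_iff)
  have link_u: "(u, par u) \<in> L d" if "key u \<le> d" for d
    using that u u0 key'[of u] par'[of u] unfolding L_def tree_links_def by (force simp: image_iff)
  \<comment> \<open>Since \<open>u\<close> has the least key, \<open>key u\<close> is at most
    \<open>d\<close>. So \<open>par u\<close> also has an edge of cost at most \<open>d\<close>
    leaving \<open>S\<close>, and the old boundary clause joins \<open>x\<close> to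
    \<open>par u\<close>.\<close>
  have exit: "(x, u) \<in> conn (L d)" if x: "x \<in> S" and y: "y < n" "y \<notin> S" "C x y \<le> d" for x y d
  proof -
    have "key u \<le> key y" using minimal y by blast
    also have "\<dots> \<le> C y x" using key_le x y by blast
    also have "\<dots> = C x y" using sym x y S(2) by (metis lessThan_iff subsetD)
    finally have ku: "key u \<le> d" using y(3) by simp
    have p: "par u \<in> S" "key u = C u (par u)" using tree u u0 by blast+
    have "C (par u) u \<le> d" using ku p sym u S(2) by (metis lessThan_iff subsetD)
    then have "(x, par u) \<in> conn (L d)"
      using boundary[rule_format, OF x p(1) y(1) u(1) y(2) u(2) y(3)] conn_mono[OF L] by blast
    moreover have "(par u, u) \<in> conn (L d)"
      using link_u[OF ku] by (intro conn_sym[OF conn_base])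
    ultimately show ?thesis by (rule conn_trans)
  qed
  have spans': "(x, y) \<in> conn (L d)"
    if xy: "x \<in> insert u S" "y \<in> insert u S" "x \<noteq> y" and d: "C x y \<le> d" for x y d
  proof -
    have "C x y = C y x" using xy u S(2) by (intro sym) auto
    then consider "x \<in> S" "y \<in> S" | "x \<in> S" "y = u" | "y \<in> S" "x = u" "C y u \<le> d"
      using xy d by auto
    then show ?thesis
    proof cases
      case 1
      then show ?thesis using spans xy d conn_mono[OF L] by blast
    next
      case 2
      then show ?thesis using exit u d by blast
    next
      case 3
      then have "(y, u) \<in> conn (L d)" using exit u by blast
      then show ?thesis using 3 by (simp add: conn_sym)
    qed
  qed
  \<comment> \<open>An edge leaving the larger set from \<open>x\<close> also leaves
    \<open>S\<close>, unless \<open>x\<close> is \<open>u\<close>. Hence any two boundary vertices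
    meet in \<open>u\<close>.\<close>
  have "(x, u) \<in> conn (L d)"
    if "x \<in> insert u S" "y < n" "y \<notin> insert u S" "C x y \<le> d" for x y d
    using that exit by (cases "x = u") auto
  then have boundary': "(x, x') \<in> conn (L d)"
    if "x \<in> insert u S" "x' \<in> insert u S" "y < n" "y' < n" "y \<notin> insert u S" "y' \<notin> insert u S"
      "C x y \<le> d" "C x' y' \<le> d" for x x' y y' d
    using that by (meson conn_sym conn_trans)
  have key_le': "key' j \<le> C j v" if "j < n" "j \<notin> insert u S" "v \<in> insert u S" for j v
    using key'[of j] key_le[of j v] sym[of u j] that u by auto
  have tree': "par' j \<in> insert u S \<and> par' j \<noteq> j \<and> key' j = C j (par' j)" if "j < n" "0 < j" for j
    using tree[OF that] key'[of j] par'[of j] sym[of u j] that u by auto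
  have "key' 0 = 0" using key'[of 0] S u by auto
  then show ?thesis
    unfolding prim_tree_def L_def[symmetric]
  proof (intro conjI)
    show "0 \<in> insert u S" "insert u S \<subseteq> {..<n}" using S u by auto
    show "\<forall>j<n. 0 < j \<longrightarrow> par' j \<in> insert u S \<and> par' j \<noteq> j \<and> key' j = C j (par' j)"
      using tree' by simp
    show "\<forall>j<n. j \<notin> insert u S \<longrightarrow> (\<forall>u\<in>insert u S. key' j \<le> C j u)"
      using key_le' by simp
  qed (assumption, intro ballI allI impI, rule spans', assumption+,
      intro ballI allI impI, rule boundary', assumption+)
qed

text \<open>The bottleneck property of a minimum spanning tree, obtained from the spanning clause
  with the threshold \<open>C u v\<close>.\<close>

lemma prim_tree_spans:
  assumes "prim_tree n C {..<n} key par" and "u < n" and "v < n"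
  shows "(u, v) \<in> conn (tree_links {..<n} key par (C u v))"
  using assms unfolding prim_tree_def by (cases "u = v") simp_all

text \<open>A single tree represents the components for every threshold.\<close>

lemma prim_tree_conn:
  assumes "prim_tree n C {..<n} key par"
  shows "conn (light n C d) = conn (tree_links {..<n} key par d)"
proof
  show "conn (light n C d) \<subseteq> conn (tree_links {..<n} key par d)"
    using assms unfolding prim_tree_def light_def by (intro conn_least) auto
  have "tree_links {..<n} key par d \<subseteq> light n C d"
    using assms unfolding prim_tree_def light_def tree_links_def by fastforce
  then show "conn (tree_links {..<n} key par d) \<subseteq> conn (light n C d)" by (rule conn_mono)
qed

text \<open>Removing the heavy edges of a spanning tree leaves one more component than edges
  removed. This lets the program count components by comparing keys.\<close>

lemma card_components_light:
  assumes tree: "prim_tree n C {..<n} key par"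
  shows "card ({..<n} // conn (light n C d)) = Suc (card {j. j < n \<and> d < key j})"
proof -
  let ?T = "tree_links {..<n} key par" and ?H = "{j. j < n \<and> d < key j}"
  have n: "0 < n" "key 0 = 0" using tree unfolding prim_tree_def by auto
  define low where "low = {j \<in> {..<n}. 0 < j \<and> key j \<le> d}"
  have "card {..<n} = card ({0} \<union> low \<union> ?H)"
    using n by (intro arg_cong[where f = card]) (auto simp: low_def)
  also have "\<dots> = Suc (card low) + card ?H"
    using n by (subst card_Un_disjoint) (auto simp: low_def)
  finally have n_eq: "n = Suc (card low) + card ?H" by simp
  \<comment> \<open>Starting from \<open>n\<close> singletons, each light tree edge lowers the
    number of components by at most one.\<close>
  have "n = card ({..<n} // conn {})" by (simp add: components_discrete)
  also have "\<dots> \<le> card ({..<n} // conn ({} \<union> ?T d)) + card (?T d)"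
    by (rule card_components_union) (auto simp: tree_links_def)
  also have "card (?T d) \<le> card low" unfolding tree_links_def low_def by (rule card_image_le) simp
  finally have lower: "Suc (card ?H) \<le> card ({..<n} // conn (?T d))" using n_eq by simp
  let ?s = "(\<lambda>j. (j, par j)) ` ?H"
  \<comment> \<open>Conversely the heavy tree edges complete the light ones to the whole tree, which
    connects everything.\<close>
  have "card ({..<n} // conn (?T d \<union> ?s)) \<le> 1"
  proof (rule components_connected)
    fix u v assume uv: "u \<in> {..<n}" "v \<in> {..<n}"
    have "?T (C u v) \<subseteq> ?T d \<union> ?s" unfolding tree_links_def by (fastforce simp: not_le)
    then show "(u, v) \<in> conn (?T d \<union> ?s)"
      using prim_tree_spans[OF tree, of u v] uv conn_mono by auto
  qed
  moreover have "card ({..<n} // conn (?T d)) \<le> card ({..<n} // conn (?T d \<union> ?s)) + card ?s"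
    by (rule card_components_union) auto
  moreover have "card ?s \<le> card ?H" by (rule card_image_le) simp
  ultimately show ?thesis using lower prim_tree_conn[OF tree] by simp
qed


section \<open>Quality of the solution\<close>

text \<open>\<open>F'\<close> and \<open>b\<close> stand for an optimal solution and its diameter;
  the edges in \<open>J\<close> do not depend on them. In \<open>C1\<close> the value
  \<open>bound\<close> marks non-edges. In \<open>C2\<close> the successor keeps pairs of weight
  \<open>0\<close> that are not free apart from the free edges.\<close>

lemma tree_solution:
  assumes n: "0 < n" and E: "E \<subseteq> [{..<n}]\<^bsup>2\<^esup>" and F': "F' \<subseteq> non_edges {..<n} E" "card F' \<le> k"
    and opt: "\<And>u v. u < n \<Longrightarrow> v < n \<Longrightarrow> within_dist (E \<union> F') w b u v"
    and bound: "\<And>u v. u < n \<Longrightarrow> v < n \<Longrightarrow> u \<noteq> v \<Longrightarrow> w {u, v} < bound"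
    and tree1: "prim_tree n C1 {..<n} key1 par1"
    and C1: "\<And>u v. u < n \<Longrightarrow> v < n \<Longrightarrow> u \<noteq> v \<Longrightarrow> C1 u v = (if {u, v} \<in> E then w {u, v} else bound)"
    and thr_le: "\<And>i. i < n \<Longrightarrow> card {j. j < n \<and> key1 i < key1 j} \<le> k \<Longrightarrow> thr \<le> key1 i"
    and thr: "thr = bound \<or> (\<exists>i<n. thr = key1 i \<and> card {j. j < n \<and> key1 i < key1 j} \<le> k)"
    and tree2: "prim_tree n C2 {..<n} key2 par2"
    and C2: "\<And>u v. u < n \<Longrightarrow> v < n \<Longrightarrow> u \<noteq> v \<Longrightarrow>
      C2 u v = (if {u, v} \<in> E \<and> w {u, v} \<le> thr then 0 else Suc (w {u, v}))"
  defines "J \<equiv> {j. j < n \<and> 0 < key2 j \<and> {j, par2 j} \<notin> E}"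
  shows "card J \<le> k"
    and "u < n \<Longrightarrow> v < n \<Longrightarrow>
      within_dist (E \<union> (\<lambda>j. {j, par2 j}) ` J) w ((3 * k + 2) * b) u v"
proof -
  have X: "E \<union> F' \<subseteq> [{..<n}]\<^bsup>2\<^esup>" using E F'(1) unfolding non_edges_def by blast
  have fin: "finite F'" using F'(1) finite_imp_finite_nsets[of "{..<n}" 2]
    unfolding non_edges_def by (metis finite_Diff finite_lessThan finite_subset)
  \<comment> \<open>Capping below \<open>bound\<close> changes no comparison with a weight but keeps
    the non-edges out of \<open>light n C1 b'\<close>.\<close>
  define b' where "b' = min b (bound - 1)"
  have b': "w {x, y} \<le> b \<longleftrightarrow> w {x, y} \<le> b'" if "x < n" "y < n" "x \<noteq> y" for x y
    using bound[OF that] unfolding b'_def by auto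
  have pair: "x < n \<and> y < n \<and> x \<noteq> y" if "{x, y} \<in> E \<union> F'" for x y
    using subsetD[OF X that] by simp
  define Lb where "Lb = {(x, y). {x, y} \<in> E \<union> F' \<and> w {x, y} \<le> b}"
  have Lb: "(x, y) \<in> conn Lb" if "x < n" "y < n" for x y
    using within_dist_conn[OF opt[OF that]] unfolding Lb_def .

  \<comment> \<open>Each edge of \<open>F'\<close> is oriented once, so at most \<open>k\<close>
    pairs are added; together with the light edges of \<open>E\<close> they connect everything.
    Hence at most \<open>k\<close> keys exceed \<open>b'\<close>.\<close>
  define s where "s = (\<lambda>e. (Min e, Max e)) ` F'"
  have "Lb \<subseteq> conn (light n C1 b' \<union> s)"
  proof clarify
    fix x y assume "(x, y) \<in> Lb"
    then have xy: "{x, y} \<in> E \<union> F'" "w {x, y} \<le> b" "x < n" "y < n" "x \<noteq> y"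
      using pair unfolding Lb_def by auto
    show "(x, y) \<in> conn (light n C1 b' \<union> s)"
    proof (cases "{x, y} \<in> E")
      case True
      then have "(x, y) \<in> light n C1 b'" using xy C1 b' unfolding light_def by auto
      then show ?thesis by (intro conn_base) simp
    next
      case False
      then have "(Min {x, y}, Max {x, y}) \<in> s" using xy unfolding s_def by blast
      then have "(x, y) \<in> s \<or> (y, x) \<in> s" using xy by (auto simp: min_def max_def split: if_splits)
      then show ?thesis by (auto intro: conn_base conn_sym)
    qed
  qed
  then have "card ({..<n} // conn (light n C1 b' \<union> s)) \<le> 1"
    using Lb conn_least by (intro components_connected) blast
  moreover have "card ({..<n} // conn (light n C1 b'))
      \<le> card ({..<n} // conn (light n C1 b' \<union> s)) + card s"
    using fin by (intro card_components_union) (auto simp: s_def)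
  moreover have "card s \<le> k" using F'(2) card_image_le[OF fin] unfolding s_def by (metis order_trans)
  ultimately have card_b': "card {j. j < n \<and> b' < key1 j} \<le> k"
    unfolding card_components_light[OF tree1] by simp

  have key0: "key1 0 = 0" "key2 0 = 0" using tree1 tree2 unfolding prim_tree_def by auto
  have b'_bound: "b' < bound" if "1 < n"
    using bound[of 0 1] that unfolding b'_def by auto
  \<comment> \<open>The largest key not above \<open>b'\<close> has the same keys above it as
    \<open>b'\<close> has, so it qualifies as a threshold and bounds \<open>thr\<close>. Then
    \<open>thr\<close> differs from \<open>bound\<close> and is itself a qualifying key.\<close>
  have "thr \<le> b' \<and> card {j. j < n \<and> thr < key1 j} \<le> k" if n1: "1 < n"
  proof -
    let ?A = "{i. i < n \<and> key1 i \<le> b'}"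
    have "Max (key1 ` ?A) \<in> key1 ` ?A" using n key0 by (intro Max_in) auto
    then obtain i where i: "i < n" "key1 i \<le> b'" "key1 i = Max (key1 ` ?A)" by auto
    have "{j. j < n \<and> key1 i < key1 j} \<subseteq> {j. j < n \<and> b' < key1 j}"
    proof clarify
      fix j assume j: "j < n" "key1 i < key1 j"
      show "b' < key1 j"
      proof (rule ccontr)
        assume "\<not> b' < key1 j"
        then have "key1 j \<le> Max (key1 ` ?A)" using j(1) by (intro Max_ge) auto
        then show False using j(2) i(3) by simp
      qed
    qed
    then have "card {j. j < n \<and> key1 i < key1 j} \<le> card {j. j < n \<and> b' < key1 j}"
      by (intro card_mono) auto
    then have "thr \<le> b'" using thr_le[OF i(1)] card_b' i(2) by linarith
    then show ?thesis using thr b'_bound[OF n1] by auto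
  qed
  \<comment> \<open>Both relations consist of the edges of \<open>E\<close> of weight at most
    \<open>thr\<close>. So the positive keys of the second tree are as many as the keys of the first
    tree above \<open>thr\<close>.\<close>
  moreover have "light n C2 0 = light n C1 thr" if "thr \<le> b'" "1 < n"
    using C1 C2 that b'_bound unfolding light_def by (auto split: if_splits)
  ultimately have thr_b': "1 < n \<Longrightarrow> thr \<le> b'" and card0: "1 < n \<Longrightarrow> card {j. j < n \<and> 0 < key2 j} \<le> k"
    using card_components_light[OF tree1, of thr] card_components_light[OF tree2, of 0] by auto
  have "card J \<le> card {j. j < n \<and> 0 < key2 j}" unfolding J_def by (intro card_mono) auto
  moreover have "{j. j < n \<and> 0 < key2 j} = {}" if "\<not> 1 < n"
  proof -
    have "j = 0" if "j < n" for j using that \<open>\<not> 1 < n\<close> by simp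
    then show ?thesis using key0 by auto
  qed
  ultimately show "card J \<le> k" using card0 by (cases "1 < n") auto

  \<comment> \<open>The optimal graph is connected by edges of weight at most \<open>b\<close>,
    whose cost in \<open>C2\<close> is at most \<open>Suc b\<close>; so no key of the second tree is
    larger.\<close>
  have "light n C2 (Suc b) \<supseteq> Lb"
  proof clarify
    fix x y assume "(x, y) \<in> Lb"
    then have "x < n \<and> y < n \<and> x \<noteq> y" "w {x, y} \<le> b" using pair unfolding Lb_def by auto
    then show "(x, y) \<in> light n C2 (Suc b)" using C2[of x y] unfolding light_def by simp
  qed
  then have "card ({..<n} // conn (light n C2 (Suc b))) \<le> 1"
    using Lb conn_mono by (intro components_connected) blast
  then have "{j. j < n \<and> Suc b < key2 j} = {}"
    unfolding card_components_light[OF tree2] by simp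
  then have key2_le: "key2 j \<le> Suc b" if "j < n" for j using that by force
  let ?F = "(\<lambda>j. {j, par2 j}) ` J"
  have parent: "par2 j < n \<and> par2 j \<noteq> j \<and> key2 j = C2 j (par2 j)" if "j < n" "0 < j" for j
    using tree2 that unfolding prim_tree_def by auto
  \<comment> \<open>A free edge weighs at most \<open>thr\<close>, hence at most \<open>b\<close>;
    for any other tree edge the shift by one in its key cancels.\<close>
  have link: "{j, par2 j} \<in> E \<union> ?F \<and> w {j, par2 j} \<le> b" if j: "j < n" "0 < j" for j
  proof
    have key2: "key2 j = (if {j, par2 j} \<in> E \<and> w {j, par2 j} \<le> thr then 0 else Suc (w {j, par2 j}))"
      using parent[OF j] C2[of j "par2 j"] j by auto
    then show "{j, par2 j} \<in> E \<union> ?F" using j unfolding J_def by auto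
    show "w {j, par2 j} \<le> b"
      using key2 key2_le[OF j(1)] thr_b' j by (auto simp: b'_def split: if_splits)
  qed
  \<comment> \<open>The hubs come from the optimal graph, but the distances to them use
    \<open>E\<close> alone and so remain valid for the computed graph.\<close>
  obtain R where R: "R \<subseteq> {..<n}" "card R \<le> Suc (card F')"
    "\<And>v. v \<in> {..<n} \<Longrightarrow> \<exists>x\<in>R. within_dist E w b v x"
    using hubs[OF _ fin X, of 0 w b] opt n by auto
  assume uv: "u < n" "v < n"
  show "within_dist (E \<union> ?F) w ((3 * k + 2) * b) u v"
  proof (rule hub_diameter)
    show "finite R" using R(1) finite_subset by blast
    show "card R \<le> Suc k" using R(2) F'(2) by simp
    show "\<exists>x\<in>R. within_dist (E \<union> ?F) w b v x" if "v \<in> {..<n}" for v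
      using R(3)[OF that] within_dist_mono[of E w b v] by blast
    show "x \<in> {..<n} \<and> y \<in> {..<n} \<and> {x, y} \<in> E \<union> ?F \<and> w {x, y} \<le> b"
      if "(x, y) \<in> (\<lambda>j. (j, par2 j)) ` {j. j < n \<and> 0 < j}" for x y
      using that link parent by auto
    have "tree_links {..<n} key2 par2 d \<subseteq> (\<lambda>j. (j, par2 j)) ` {j. j < n \<and> 0 < j}" for d
      unfolding tree_links_def by auto
    then show "(u, v) \<in> conn ((\<lambda>j. (j, par2 j)) ` {j. j < n \<and> 0 < j})"
      using prim_tree_spans[OF tree2 uv] conn_mono by blast
  qed (use uv in auto)
qed


section \<open>Reasoning about programs\<close>

text \<open>Total correctness with a time bound. As execution is deterministic, asserting one
  terminating run loses nothing.\<close>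

definition runs :: "com \<Rightarrow> nat \<Rightarrow> state \<Rightarrow> (state \<Rightarrow> bool) \<Rightarrow> bool" where
  "runs P T s Q \<longleftrightarrow> (\<exists>t s'. exec P s t s' \<and> t \<le> T \<and> Q s')"

lemma runs_weaken:
  assumes "runs P T s Q" and "T \<le> T'" and "\<And>s'. Q s' \<Longrightarrow> Q' s'"
  shows "runs P T' s Q'"
  using assms unfolding runs_def by (meson order_trans)

lemma runs_Seq:
  assumes "runs P T s R" and "\<And>s'. R s' \<Longrightarrow> runs P' T' s' Q" and "1 + T + T' \<le> U"
  shows "runs (Seq P P') U s Q"
proof -
  from assms(1) obtain t s' where 1: "exec P s t s'" "t \<le> T" "R s'" unfolding runs_def by blast
  from assms(2)[OF 1(3)] obtain t' s'' where 2: "exec P' s' t' s''" "t' \<le> T'" "Q s''"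
    unfolding runs_def by blast
  show ?thesis
    unfolding runs_def using exec_Seq[OF 1(1) 2(1)] 1(2) 2(2,3) assms(3)
    by (intro exI[of _ "1 + t + t'"] exI[of _ s'']) simp
qed

fun loop_free :: "com \<Rightarrow> bool" where
  "loop_free (Seq P Q) \<longleftrightarrow> loop_free P \<and> loop_free Q"
| "loop_free (Cond b P Q) \<longleftrightarrow> loop_free P \<and> loop_free Q"
| "loop_free (While b P) \<longleftrightarrow> False"
| "loop_free _ \<longleftrightarrow> True"

text \<open>The values of the following two functions at \<open>While\<close> are junk.\<close>

fun result :: "com \<Rightarrow> state \<Rightarrow> state" where
  "result (Write x i e) s = s(x := (s x)(aval i s := aval e s))"
| "result (Seq P Q) s = result Q (result P s)"
| "result (Cond b P Q) s = (if bval b s then result P s else result Q s)"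
| "result _ s = s"

fun max_cost :: "com \<Rightarrow> nat" where
  "max_cost (Write x i e) = 1 + acost i + acost e"
| "max_cost (Seq P Q) = 1 + max_cost P + max_cost Q"
| "max_cost (Cond b P Q) = 1 + bcost b + max (max_cost P) (max_cost Q)"
| "max_cost _ = 1"

text \<open>This reduces straight-line and branching code to simplification with
  \<open>result\<close> and \<open>max_cost\<close>; only loops need invariants.\<close>

lemma exec_loop_free:
  assumes "loop_free P"
  shows "\<exists>t \<le> max_cost P. exec P s t (result P s)"
  using assms
proof (induction P arbitrary: s)
  case Skip
  then show ?case using exec_Skip by auto
next
  case (Write x i e)
  then show ?case using exec_Write by (metis max_cost.simps(1) order_refl result.simps(1))
next
  case (Seq P Q)
  then obtain t t' where "t \<le> max_cost P" "exec P s t (result P s)"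
    "t' \<le> max_cost Q" "exec Q (result P s) t' (result Q (result P s))"
    by (metis loop_free.simps(1))
  then show ?case by (intro exI[of _ "1 + t + t'"]) (auto intro: exec_Seq[simplified])
next
  case (Cond b P Q)
  show ?case
  proof (cases "bval b s")
    case True
    moreover obtain t where "t \<le> max_cost P" "exec P s t (result P s)"
      using Cond by (metis loop_free.simps(2))
    ultimately show ?thesis
      by (intro exI[of _ "1 + bcost b + t"]) (auto intro: exec_CondTrue[simplified])
  next
    case False
    moreover obtain t where "t \<le> max_cost Q" "exec Q s t (result Q s)"
      using Cond by (metis loop_free.simps(2))
    ultimately show ?thesis
      by (intro exI[of _ "1 + bcost b + t"]) (auto intro: exec_CondFalse[simplified])
  qed
qed simp

lemma runs_loop_free:
  assumes "loop_free P" and "max_cost P \<le> T" and "Q (result P s)"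
  shows "runs P T s Q"
  using exec_loop_free[OF assms(1), of s] assms(2,3) unfolding runs_def by (meson order_trans)

text \<open>The invariant is indexed by the number of completed rounds, and the induction runs
  downwards from \<open>N\<close>. The last summand pays for the failing test.\<close>

lemma runs_While:
  assumes body: "\<And>i s. i < N \<Longrightarrow> I i s \<Longrightarrow> bval b s \<and> runs P T s (I (Suc i))"
    and final: "\<And>s. I N s \<Longrightarrow> \<not> bval b s"
    and "i \<le> N" and "I i s"
  shows "runs (While b P) ((N - i) * (1 + bcost b + T) + (1 + bcost b)) s (I N)"
  using assms(3,4)
proof (induction i arbitrary: s rule: inc_induct)
  case base
  then show ?case using exec_WhileFalse final unfolding runs_def by fastforce
next
  case (step i)
  obtain t s' where 1: "exec P s t s'" "t \<le> T" "I (Suc i) s'"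
    using body[OF step.hyps(2) step.prems] unfolding runs_def by blast
  obtain t' s'' where 2: "exec (While b P) s' t' s''" "I N s''"
    "t' \<le> (N - Suc i) * (1 + bcost b + T) + (1 + bcost b)"
    using step.IH[OF 1(3)] unfolding runs_def by blast
  have "exec (While b P) s (1 + bcost b + t + t') s''"
    using body[OF step.hyps(2) step.prems] 1(1) 2(1) by (intro exec_WhileTrue) auto
  moreover have "N - i = Suc (N - Suc i)" using step.hyps(2) by simp
  then have "1 + bcost b + t + t' \<le> (N - i) * (1 + bcost b + T) + (1 + bcost b)"
    using 1(2) 2(3) by simp
  ultimately show ?case using 2(2) unfolding runs_def by blast
qed

abbreviation var :: "string \<Rightarrow> aexp" where
  "var x \<equiv> Read x (Const 0)"

abbreviation assign :: "string \<Rightarrow> aexp \<Rightarrow> com" where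
  "assign x e \<equiv> Write x (Const 0) e"

definition For :: "string \<Rightarrow> aexp \<Rightarrow> com \<Rightarrow> com" where
  "For x e P = Seq (assign x (Const 0))
     (While (Less (var x) e) (Seq P (assign x (Add (var x) (Const 1)))))"

text \<open>The limit \<open>e\<close> is evaluated anew in each round, so the invariant must fix
  its value. Test, sequencing and increment cost \<open>acost e + 11\<close> per round;
  initialisation, outer sequencing and last test cost \<open>acost e + 8\<close>.\<close>

lemma runs_For:
  assumes inv: "\<And>i s. I i s \<Longrightarrow> s x 0 = i \<and> aval e s = N"
    and init: "I 0 (s(x := (s x)(0 := 0)))"
    and body: "\<And>i s. i < N \<Longrightarrow> I i s \<Longrightarrow>
      runs P T s (\<lambda>s'. I (Suc i) (s'(x := (s' x)(0 := Suc (s' x 0)))))"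
    and final: "\<And>s. I N s \<Longrightarrow> Q s"
    and time: "N * (T + acost e + 11) + acost e + 8 \<le> U"
  shows "runs (For x e P) U s Q"
  unfolding For_def
proof (rule runs_Seq)
  show "runs (assign x (Const 0)) 3 s (I 0)" using init by (intro runs_loop_free) auto
  fix s assume "I 0 s"
  have "runs (While (Less (var x) e) (Seq P (assign x (Add (var x) (Const 1)))))
    ((N - 0) * (1 + bcost (Less (var x) e) + (T + 7)) + (1 + bcost (Less (var x) e))) s (I N)"
  proof (rule runs_While)
    fix i s assume i: "i < N" "I i s"
    have "runs (Seq P (assign x (Add (var x) (Const 1)))) (T + 7) s (I (Suc i))"
      by (rule runs_Seq[OF body[OF i]]) (auto intro!: runs_loop_free[where T = 6])
    then show "bval (Less (var x) e) s \<and>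
        runs (Seq P (assign x (Add (var x) (Const 1)))) (T + 7) s (I (Suc i))"
      using inv[OF i(2)] i(1) by simp
  next
    fix s assume "I N s"
    then show "\<not> bval (Less (var x) e) s" using inv[of N s] by simp
  qed (use \<open>I 0 s\<close> in auto)
  then show "runs (While (Less (var x) e) (Seq P (assign x (Add (var x) (Const 1)))))
    (N * (T + acost e + 11) + acost e + 4) s Q"
    by (rule runs_weaken) (auto simp: algebra_simps final)
qed (use time in simp)

lemma runs_For_loop_free:
  assumes "loop_free P" and "\<And>i s. I i s \<Longrightarrow> s x 0 = i \<and> aval e s = N"
    and "I 0 (s(x := (s x)(0 := 0)))"
    and "\<And>i s. i < N \<Longrightarrow> I i s \<Longrightarrow>
      I (Suc i) ((result P s)(x := (result P s x)(0 := Suc (result P s x 0))))"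
    and "\<And>s. I N s \<Longrightarrow> Q s"
    and "N * (max_cost P + acost e + 11) + acost e + 8 \<le> U"
  shows "runs (For x e P) U s Q"
  using assms by (intro runs_For[of I x e N s P "max_cost P"] runs_loop_free) auto


section \<open>The approximation algorithm\<close>

text \<open>The machine cannot multiply, so row offsets are tabulated by repeated addition. The
  entry at \<open>n\<close> is \<open>n * n\<close>, the limit of the loops over a whole
  matrix.\<close>

definition rows_prog :: com where
  "rows_prog = For ''i'' (var ''n'')
     (Write ''row'' (Add (var ''i'') (Const 1)) (Add (Read ''row'' (var ''i'')) (var ''n'')))"

lemma runs_rows:
  assumes "s ''n'' 0 = n" and "s ''row'' 0 = 0" and "0 < n"
  shows "runs rows_prog (40 * n\<^sup>2) s (\<lambda>s'. (\<forall>a\<le>n. s' ''row'' a = a * n) \<and>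
    (\<forall>x. x \<notin> {''i'', ''row''} \<longrightarrow> s' x = s x))"
  unfolding rows_prog_def
proof (rule runs_For_loop_free[where N = n and I = "\<lambda>i s'. s' ''i'' 0 = i \<and>
    (\<forall>a\<le>i. s' ''row'' a = a * n) \<and> (\<forall>x. x \<notin> {''i'', ''row''} \<longrightarrow> s' x = s x)"])
  have "n \<le> n\<^sup>2" "1 \<le> n\<^sup>2" using assms(3) by (simp_all add: power2_eq_square)
  then show "n * (max_cost (Write ''row'' (Add (var ''i'') (Const 1))
      (Add (Read ''row'' (var ''i'')) (var ''n''))) + acost (var ''n'') + 11) + acost (var ''n'') + 8
      \<le> 40 * n\<^sup>2" by simp
qed (use assms in \<open>auto simp: le_Suc_eq\<close>)

section \<open>Linear passes over the matrices\<close>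

lemma runs_For_matrix:
  assumes "loop_free P" and "0 < n"
    and "\<And>i s. I i s \<Longrightarrow> s ''i'' 0 = i \<and> s ''n'' 0 = n \<and> s ''row'' n = n * n"
    and "I 0 (s(''i'' := (s ''i'')(0 := 0)))"
    and "\<And>i s. i < n * n \<Longrightarrow> I i s \<Longrightarrow>
      I (Suc i) ((result P s)(''i'' := (result P s ''i'')(0 := Suc (result P s ''i'' 0))))"
    and "\<And>s. I (n * n) s \<Longrightarrow> Q s"
  shows "runs (For ''i'' (Read ''row'' (var ''n'')) P) ((max_cost P + 25) * n\<^sup>2) s Q"
proof (rule runs_For_loop_free[OF assms(1) _ assms(4,5) assms(6)])
  have "1 \<le> n\<^sup>2" using assms(2) by simp
  then show "n * n * (max_cost P + acost (Read ''row'' (var ''n'')) + 11)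
      + acost (Read ''row'' (var ''n'')) + 8 \<le> (max_cost P + 25) * n\<^sup>2"
    by (simp add: power2_eq_square algebra_simps)
qed (use assms(3) in auto)

text \<open>Summing all entries, each increased by one, gives a value strictly above every
  weight.\<close>

definition bound_prog :: com where
  "bound_prog = For ''i'' (Read ''row'' (var ''n''))
     (assign ''bound'' (Add (Add (var ''bound'') (Read ''weight'' (var ''i''))) (Const 1)))"

lemma runs_bound:
  assumes "s ''n'' 0 = n" and "s ''row'' n = n * n" and "0 < n"
  shows "runs bound_prog (40 * n\<^sup>2) s (\<lambda>s'. (\<forall>a<n * n. s' ''weight'' a < s' ''bound'' 0) \<and>
    (\<forall>x. x \<notin> {''i'', ''bound''} \<longrightarrow> s' x = s x))"
  unfolding bound_prog_def
  by (rule runs_weaken[OF runs_For_matrix[where n = n and I = "\<lambda>i s'. s' ''i'' 0 = i \<and>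
    (\<forall>a<i. s ''weight'' a < s' ''bound'' 0) \<and> (\<forall>x. x \<notin> {''i'', ''bound''} \<longrightarrow> s' x = s x)"]])
    (use assms in \<open>simp_all add: All_less_Suc less_SucI trans_less_add1\<close>)

definition graph_costs_prog :: com where
  "graph_costs_prog = For ''i'' (Read ''row'' (var ''n''))
     (Cond (Equal (Read ''adj'' (var ''i'')) (Const 1))
       (Write ''cost'' (var ''i'') (Read ''weight'' (var ''i'')))
       (Write ''cost'' (var ''i'') (var ''bound'')))"

lemma runs_graph_costs:
  assumes "s ''n'' 0 = n" and "s ''row'' n = n * n" and "0 < n"
  shows "runs graph_costs_prog (40 * n\<^sup>2) s (\<lambda>s'.
    (\<forall>a<n * n. s' ''cost'' a = (if s ''adj'' a = 1 then s ''weight'' a else s ''bound'' 0)) \<and>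
    (\<forall>x. x \<notin> {''i'', ''cost''} \<longrightarrow> s' x = s x))"
  unfolding graph_costs_prog_def
  by (rule runs_weaken[OF runs_For_matrix[where n = n and I = "\<lambda>i s'. s' ''i'' 0 = i \<and>
    (\<forall>a<i. s' ''cost'' a = (if s ''adj'' a = 1 then s ''weight'' a else s ''bound'' 0)) \<and>
    (\<forall>x. x \<notin> {''i'', ''cost''} \<longrightarrow> s' x = s x)"]])
    (use assms in \<open>auto simp: less_Suc_eq\<close>)

text \<open>Edges up to the threshold become free, so a positive key later identifies a tree edge
  that joins two components.\<close>

definition completion_costs_prog :: com where
  "completion_costs_prog = For ''i'' (Read ''row'' (var ''n''))
     (Cond (Conj (Equal (Read ''adj'' (var ''i'')) (Const 1))
         (Neg (Less (var ''thr'') (Read ''weight'' (var ''i'')))))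
       (Write ''cost'' (var ''i'') (Const 0))
       (Write ''cost'' (var ''i'') (Add (Read ''weight'' (var ''i'')) (Const 1))))"

lemma runs_completion_costs:
  assumes "s ''n'' 0 = n" and "s ''row'' n = n * n" and "0 < n"
  shows "runs completion_costs_prog (60 * n\<^sup>2) s (\<lambda>s'.
    (\<forall>a<n * n. s' ''cost'' a =
      (if s ''adj'' a = 1 \<and> s ''weight'' a \<le> s ''thr'' 0 then 0 else Suc (s ''weight'' a))) \<and>
    (\<forall>x. x \<notin> {''i'', ''cost''} \<longrightarrow> s' x = s x))"
  unfolding completion_costs_prog_def
  by (rule runs_weaken[OF runs_For_matrix[where n = n and I = "\<lambda>i s'. s' ''i'' 0 = i \<and>
    (\<forall>a<i. s' ''cost'' a =
      (if s ''adj'' a = 1 \<and> s ''weight'' a \<le> s ''thr'' 0 then 0 else Suc (s ''weight'' a))) \<and>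
    (\<forall>x. x \<notin> {''i'', ''cost''} \<longrightarrow> s' x = s x)"]])
    (use assms in \<open>auto simp: less_Suc_eq\<close>)

section \<open>Prim's algorithm as a program\<close>

definition prim_init_prog :: com where
  "prim_init_prog = Seq
     (For ''j'' (var ''n'')
       (Seq (Write ''key'' (var ''j'') (Read ''cost'' (var ''j'')))
         (Seq (Write ''par'' (var ''j'') (Const 0)) (Write ''vis'' (var ''j'') (Const 0)))))
     (Seq (assign ''key'' (Const 0)) (assign ''vis'' (Const 1)))"

text \<open>Row \<open>0\<close> of the matrix fills the first \<open>n\<close> cells of
  \<open>cost\<close>, so these are the costs of reaching each vertex from the root. Resetting
  \<open>vis\<close> matters because the algorithm runs twice.\<close>

lemma runs_prim_init:
  assumes "s ''n'' 0 = n" and "0 < n"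
  shows "runs prim_init_prog (60 * n) s (\<lambda>s'.
    (\<forall>j<n. s' ''key'' j = (if j = 0 then 0 else s ''cost'' j) \<and> s' ''par'' j = 0 \<and>
      (0 < s' ''vis'' j \<longleftrightarrow> j = 0)) \<and>
    (\<forall>x. x \<notin> {''j'', ''key'', ''par'', ''vis''} \<longrightarrow> s' x = s x))"
  unfolding prim_init_prog_def
proof (rule runs_Seq[where T' = 7])
  show "runs (For ''j'' (var ''n'')
       (Seq (Write ''key'' (var ''j'') (Read ''cost'' (var ''j'')))
         (Seq (Write ''par'' (var ''j'') (Const 0)) (Write ''vis'' (var ''j'') (Const 0)))))
     (50 * n) s (\<lambda>s'. (\<forall>j<n. s' ''key'' j = s ''cost'' j \<and> s' ''par'' j = 0 \<and> s' ''vis'' j = 0) \<and>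
    (\<forall>x. x \<notin> {''j'', ''key'', ''par'', ''vis''} \<longrightarrow> s' x = s x))"
    by (rule runs_For_loop_free[where N = n and I = "\<lambda>i s'. s' ''j'' 0 = i \<and>
      (\<forall>j<i. s' ''key'' j = s ''cost'' j \<and> s' ''par'' j = 0 \<and> s' ''vis'' j = 0) \<and>
      (\<forall>x. x \<notin> {''j'', ''key'', ''par'', ''vis''} \<longrightarrow> s' x = s x)"])
      (use assms in \<open>auto simp: less_Suc_eq\<close>)
  fix s1 :: state
  assume s1: "(\<forall>j<n. s1 ''key'' j = s ''cost'' j \<and> s1 ''par'' j = 0 \<and> s1 ''vis'' j = 0) \<and>
    (\<forall>x. x \<notin> {''j'', ''key'', ''par'', ''vis''} \<longrightarrow> s1 x = s x)"
  show "runs (Seq (assign ''key'' (Const 0)) (assign ''vis'' (Const 1))) 7 s1 (\<lambda>s'.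
    (\<forall>j<n. s' ''key'' j = (if j = 0 then 0 else s ''cost'' j) \<and> s' ''par'' j = 0 \<and>
      (0 < s' ''vis'' j \<longleftrightarrow> j = 0)) \<and>
    (\<forall>x. x \<notin> {''j'', ''key'', ''par'', ''vis''} \<longrightarrow> s' x = s x))"
    by (rule runs_loop_free) (use s1 in simp_all)
qed (use assms in simp)

definition prim_select_prog :: com where
  "prim_select_prog = Seq (assign ''u'' (Const 0))
     (For ''j'' (var ''n'')
       (Cond (Conj (Equal (Read ''vis'' (var ''j'')) (Const 0))
           (Neg (Conj (Equal (Read ''vis'' (var ''u'')) (Const 0))
             (Neg (Less (Read ''key'' (var ''j'')) (Read ''key'' (var ''u'')))))))
         (assign ''u'' (var ''j'')) Skip))"

text \<open>Vertex \<open>0\<close> is always visited, so that an unvisited \<open>u\<close> means that a candidate was found.\<close>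

lemma runs_prim_select:
  assumes "s ''n'' 0 = n" and "s ''vis'' 0 \<noteq> 0" and "0 < n"
    and "\<exists>j<n. s ''vis'' j = 0"
  shows "runs prim_select_prog (80 * n) s (\<lambda>s'.
    s' ''u'' 0 < n \<and> s ''vis'' (s' ''u'' 0) = 0 \<and>
    (\<forall>j<n. s ''vis'' j = 0 \<longrightarrow> s ''key'' (s' ''u'' 0) \<le> s ''key'' j) \<and>
    (\<forall>x. x \<notin> {''j'', ''u''} \<longrightarrow> s' x = s x))"
  unfolding prim_select_prog_def
proof (rule runs_Seq)
  show "runs (assign ''u'' (Const 0)) 3 s (\<lambda>s'. s' ''u'' 0 = 0 \<and> (\<forall>x. x \<noteq> ''u'' \<longrightarrow> s' x = s x))"
    by (rule runs_loop_free) auto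
  fix s1 :: state assume s1: "s1 ''u'' 0 = 0 \<and> (\<forall>x. x \<noteq> ''u'' \<longrightarrow> s1 x = s x)"
  show "runs (For ''j'' (var ''n'')
       (Cond (Conj (Equal (Read ''vis'' (var ''j'')) (Const 0))
           (Neg (Conj (Equal (Read ''vis'' (var ''u'')) (Const 0))
             (Neg (Less (Read ''key'' (var ''j'')) (Read ''key'' (var ''u'')))))))
         (assign ''u'' (var ''j'')) Skip)) (70 * n) s1 (\<lambda>s'.
    s' ''u'' 0 < n \<and> s ''vis'' (s' ''u'' 0) = 0 \<and>
    (\<forall>j<n. s ''vis'' j = 0 \<longrightarrow> s ''key'' (s' ''u'' 0) \<le> s ''key'' j) \<and>
    (\<forall>x. x \<notin> {''j'', ''u''} \<longrightarrow> s' x = s x))"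
    \<comment> \<open>The invariant claims that \<open>u\<close> is unvisited only once some
      unvisited \<open>j\<close> has been scanned; until then \<open>u\<close> is still the
      root.\<close>
    by (rule runs_For_loop_free[where N = n and I = "\<lambda>i s'. s' ''j'' 0 = i \<and> s' ''u'' 0 < n \<and>
      (\<forall>j<i. s ''vis'' j = 0 \<longrightarrow>
        s ''vis'' (s' ''u'' 0) = 0 \<and> s ''key'' (s' ''u'' 0) \<le> s ''key'' j) \<and>
      (\<forall>x. x \<notin> {''j'', ''u''} \<longrightarrow> s' x = s x)"])
      (use assms s1 in \<open>auto simp: less_Suc_eq\<close>)
qed (use assms in simp)

definition prim_update_prog :: com where
  "prim_update_prog = For ''j'' (var ''n'')
     (Cond (Conj (Equal (Read ''vis'' (var ''j'')) (Const 0))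
         (Less (Read ''cost'' (Add (Read ''row'' (var ''u'')) (var ''j''))) (Read ''key'' (var ''j''))))
       (Seq (Write ''key'' (var ''j'') (Read ''cost'' (Add (Read ''row'' (var ''u'')) (var ''j''))))
         (Write ''par'' (var ''j'') (var ''u''))) Skip)"

lemma runs_prim_update:
  assumes "s ''n'' 0 = n" and "0 < n"
  defines "c \<equiv> \<lambda>j. s ''cost'' (s ''row'' (s ''u'' 0) + j)"
  shows "runs prim_update_prog (80 * n) s (\<lambda>s'.
    (\<forall>j<n. s' ''key'' j =
        (if s ''vis'' j = 0 \<and> c j < s ''key'' j then c j else s ''key'' j) \<and>
      s' ''par'' j =
        (if s ''vis'' j = 0 \<and> c j < s ''key'' j then s ''u'' 0 else s ''par'' j)) \<and>
    (\<forall>x. x \<notin> {''j'', ''key'', ''par''} \<longrightarrow> s' x = s x))"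
  unfolding prim_update_prog_def
  \<comment> \<open>The clause for indices from \<open>i\<close> on is needed since each round
    compares with the old key of its own index.\<close>
  by (rule runs_For_loop_free[where N = n and I = "\<lambda>i s'. s' ''j'' 0 = i \<and>
    (\<forall>j<i. s' ''key'' j =
        (if s ''vis'' j = 0 \<and> c j < s ''key'' j then c j else s ''key'' j) \<and>
      s' ''par'' j =
        (if s ''vis'' j = 0 \<and> c j < s ''key'' j then s ''u'' 0 else s ''par'' j)) \<and>
    (\<forall>j\<ge>i. s' ''key'' j = s ''key'' j \<and> s' ''par'' j = s ''par'' j) \<and>
    (\<forall>x. x \<notin> {''j'', ''key'', ''par''} \<longrightarrow> s' x = s x)"])
    (use assms in \<open>auto simp: less_Suc_eq\<close>)

definition prim_prog :: com where
  "prim_prog = Seq prim_init_prog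
     (For ''q'' (Sub (var ''n'') (Const 1))
       (Seq prim_select_prog (Seq (Write ''vis'' (var ''u'') (Const 1)) prim_update_prog)))"

text \<open>The visited cells are the set \<open>S\<close> of \<open>prim_tree\<close>. Starting
  from the root, \<open>n - 1\<close> rounds of linear cost visit everything.\<close>

lemma runs_prim:
  fixes s :: state
  assumes s: "s ''n'' 0 = n" "\<And>a. a < n \<Longrightarrow> s ''row'' a = a * n" and n: "0 < n"
  defines "C \<equiv> \<lambda>u v. s ''cost'' (u * n + v)"
  assumes sym: "\<And>u v. u < n \<Longrightarrow> v < n \<Longrightarrow> u \<noteq> v \<Longrightarrow> C u v = C v u"
  shows "runs prim_prog (400 * n\<^sup>2) s (\<lambda>s'. prim_tree n C {..<n} (s' ''key'') (s' ''par'') \<and>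
    (\<forall>x. x \<notin> {''j'', ''q'', ''u'', ''key'', ''par'', ''vis''} \<longrightarrow> s' x = s x))"
proof -
  define frame where "frame s' \<longleftrightarrow>
    (\<forall>x. x \<notin> {''j'', ''q'', ''u'', ''key'', ''par'', ''vis''} \<longrightarrow> s' x = s x)" for s' :: state
  define visited where "visited s' = {j. j < n \<and> s' ''vis'' j \<noteq> 0}" for s' :: state
  define I where "I q s' \<longleftrightarrow> s' ''q'' 0 = q \<and> card (visited s') = Suc q \<and> frame s' \<and>
    prim_tree n C (visited s') (s' ''key'') (s' ''par'')" for q and s' :: state
  let ?body = "Seq prim_select_prog (Seq (Write ''vis'' (var ''u'') (Const 1)) prim_update_prog)"
  have step: "runs ?body (200 * n) s1 (\<lambda>s'. I (Suc q) (s'(''q'' := (s' ''q'')(0 := Suc (s' ''q'' 0)))))"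
    if q: "q < n - 1" and I: "I q s1" for q s1
  proof (rule runs_Seq)
    have frame1: "frame s1" and tree1: "prim_tree n C (visited s1) (s1 ''key'') (s1 ''par'')"
      using I unfolding I_def by auto
    have n1: "s1 ''n'' 0 = n" using frame1 s(1) unfolding frame_def by simp
    \<comment> \<open>Before round \<open>q\<close> exactly \<open>q + 1\<close> vertices are
      visited, fewer than \<open>n\<close>.\<close>
    have "\<exists>j<n. s1 ''vis'' j = 0"
    proof (rule ccontr)
      assume "\<not> (\<exists>j<n. s1 ''vis'' j = 0)"
      then have "visited s1 = {..<n}" unfolding visited_def by auto
      then show False using q I unfolding I_def by simp
    qed
    moreover have "s1 ''vis'' 0 \<noteq> 0" using tree1 unfolding prim_tree_def visited_def by simp
    ultimately show "runs prim_select_prog (80 * n) s1 (\<lambda>s'.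
      s' ''u'' 0 < n \<and> s1 ''vis'' (s' ''u'' 0) = 0 \<and>
      (\<forall>j<n. s1 ''vis'' j = 0 \<longrightarrow> s1 ''key'' (s' ''u'' 0) \<le> s1 ''key'' j) \<and>
      (\<forall>x. x \<notin> {''j'', ''u''} \<longrightarrow> s' x = s1 x))"
      using n1 n by (intro runs_prim_select) auto
    fix s2 :: state
    assume "s2 ''u'' 0 < n \<and> s1 ''vis'' (s2 ''u'' 0) = 0 \<and>
      (\<forall>j<n. s1 ''vis'' j = 0 \<longrightarrow> s1 ''key'' (s2 ''u'' 0) \<le> s1 ''key'' j) \<and>
      (\<forall>x. x \<notin> {''j'', ''u''} \<longrightarrow> s2 x = s1 x)"
    then have u: "s2 ''u'' 0 < n" "s1 ''vis'' (s2 ''u'' 0) = 0"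
        "\<And>j. j < n \<Longrightarrow> s1 ''vis'' j = 0 \<Longrightarrow> s1 ''key'' (s2 ''u'' 0) \<le> s1 ''key'' j"
      and frame2: "\<And>x. x \<notin> {''j'', ''u''} \<Longrightarrow> s2 x = s1 x" by blast+
    define u where "u = s2 ''u'' 0"
    define s3 where "s3 = s2(''vis'' := (s2 ''vis'')(u := 1))"
    have frame3: "s3 x = s1 x" if "x \<notin> {''j'', ''u'', ''vis''}" for x
      using that frame2 unfolding s3_def by simp
    have vis3: "s3 ''vis'' = (s1 ''vis'')(u := 1)" and u3: "s3 ''u'' 0 = u"
      using frame2[of "''vis''"] unfolding s3_def u_def by simp_all
    have row3: "s3 ''row'' u = u * n" and cost3: "s3 ''cost'' = s ''cost''" and n3: "s3 ''n'' 0 = n"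
      using frame3 frame1 s u(1) unfolding frame_def u_def by simp_all
    show "runs (Seq (Write ''vis'' (var ''u'') (Const 1)) prim_update_prog) (100 * n) s2
      (\<lambda>s'. I (Suc q) (s'(''q'' := (s' ''q'')(0 := Suc (s' ''q'' 0)))))"
    proof (rule runs_Seq)
      show "runs (Write ''vis'' (var ''u'') (Const 1)) 4 s2 (\<lambda>s'. s' = s3)"
        by (rule runs_loop_free) (simp_all add: s3_def u_def)
      show "runs prim_update_prog (80 * n) s'
        (\<lambda>s'. I (Suc q) (s'(''q'' := (s' ''q'')(0 := Suc (s' ''q'' 0)))))" if "s' = s3" for s'
        unfolding that
      proof (rule runs_weaken[OF runs_prim_update[where n = n] order_refl])
        show "s3 ''n'' 0 = n" "0 < n" using n3 n by auto
        fix s4 :: state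
        assume "(\<forall>j<n. s4 ''key'' j =
              (if s3 ''vis'' j = 0 \<and> s3 ''cost'' (s3 ''row'' (s3 ''u'' 0) + j) < s3 ''key'' j
               then s3 ''cost'' (s3 ''row'' (s3 ''u'' 0) + j) else s3 ''key'' j) \<and>
            s4 ''par'' j =
              (if s3 ''vis'' j = 0 \<and> s3 ''cost'' (s3 ''row'' (s3 ''u'' 0) + j) < s3 ''key'' j
               then s3 ''u'' 0 else s3 ''par'' j)) \<and>
          (\<forall>x. x \<notin> {''j'', ''key'', ''par''} \<longrightarrow> s4 x = s3 x)"
        then have key4: "\<And>j. j < n \<Longrightarrow> s4 ''key'' j =
              (if s3 ''vis'' j = 0 \<and> C u j < s1 ''key'' j then C u j else s1 ''key'' j)"
          and par4: "\<And>j. j < n \<Longrightarrow> s4 ''par'' j =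
              (if s3 ''vis'' j = 0 \<and> C u j < s1 ''key'' j then u else s1 ''par'' j)"
          and frame4: "\<And>x. x \<notin> {''j'', ''key'', ''par''} \<Longrightarrow> s4 x = s3 x"
          unfolding u3 row3 cost3 C_def using frame3[of "''key''"] frame3[of "''par''"] by simp_all
        have visited4: "visited s4 = insert u (visited s1)"
          using frame4[of "''vis''"] u(1) unfolding visited_def vis3 u_def by auto
        have u_new: "u < n" "u \<notin> visited s1" using u unfolding u_def visited_def by auto
        have vis3_iff: "s3 ''vis'' j = 0 \<longleftrightarrow> j \<notin> insert u (visited s1)" if "j < n" for j
          using that unfolding vis3 visited_def by simp
        have "prim_tree n C (visited s4) (s4 ''key'') (s4 ''par'')"
          unfolding visited4
        proof (rule prim_tree_step[OF tree1 sym u_new])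
          show "s1 ''key'' u \<le> s1 ''key'' j" if "j < n" "j \<notin> visited s1" for j
            using that u(3)[of j] unfolding u_def visited_def by simp
        qed (simp_all add: key4 par4 vis3_iff)
        moreover have "frame s4"
          using frame4 frame3 frame1 unfolding frame_def by simp
        moreover have "card (visited s4) = Suc (Suc q)"
          unfolding visited4 using u_new(2) I by (simp add: I_def visited_def)
        moreover have "s4 ''q'' 0 = q"
          using frame4[of "''q''"] frame3[of "''q''"] I unfolding I_def by simp
        ultimately show "I (Suc q) (s4(''q'' := (s4 ''q'')(0 := Suc (s4 ''q'' 0))))"
          unfolding I_def frame_def visited_def by simp
      qed
    qed (use n in simp)
  qed (use n in simp)
  show ?thesis
    unfolding prim_prog_def
  proof (rule runs_Seq[OF runs_prim_init[where n = n]])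
    show "s ''n'' 0 = n" "0 < n" using s n by auto
    fix s1 :: state
    assume s1: "(\<forall>j<n. s1 ''key'' j = (if j = 0 then 0 else s ''cost'' j) \<and> s1 ''par'' j = 0 \<and>
        (0 < s1 ''vis'' j \<longleftrightarrow> j = 0)) \<and>
      (\<forall>x. x \<notin> {''j'', ''key'', ''par'', ''vis''} \<longrightarrow> s1 x = s x)"
    show "runs (For ''q'' (Sub (var ''n'') (Const 1)) ?body) (300 * n\<^sup>2) s1
      (\<lambda>s'. prim_tree n C {..<n} (s' ''key'') (s' ''par'') \<and>
        (\<forall>x. x \<notin> {''j'', ''q'', ''u'', ''key'', ''par'', ''vis''} \<longrightarrow> s' x = s x))"
    proof (rule runs_For[where I = I and N = "n - 1" and T = "200 * n"])
      show "s2 ''q'' 0 = q \<and> aval (Sub (var ''n'') (Const 1)) s2 = n - 1" if "I q s2" for q s2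
        using that s(1) unfolding I_def frame_def by simp
      let ?s2 = "s1(''q'' := (s1 ''q'')(0 := 0))"
      have "0 < s1 ''vis'' j \<longleftrightarrow> j = 0" if "j < n" for j
        using s1 that by simp
      then have "visited ?s2 = {0}" using n unfolding visited_def by auto
      moreover have "prim_tree n C {0} (?s2 ''key'') (?s2 ''par'')"
      proof (rule prim_tree_init)
        show "?s2 ''par'' j = 0 \<and> ?s2 ''key'' j = C j 0" if "0 < j" "j < n" for j
          using s1 that n sym[of 0 j] by (simp add: C_def)
      qed (use s1 n in simp_all)
      ultimately show "I 0 ?s2" using s1 unfolding I_def frame_def by simp
      show "prim_tree n C {..<n} (s2 ''key'') (s2 ''par'') \<and>
          (\<forall>x. x \<notin> {''j'', ''q'', ''u'', ''key'', ''par'', ''vis''} \<longrightarrow> s2 x = s x)"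
        if I: "I (n - 1) s2" for s2
      proof -
        have "visited s2 = {..<n}"
          using I n unfolding I_def by (intro card_subset_eq) (auto simp: visited_def)
        then show ?thesis using I unfolding I_def frame_def by simp
      qed
      have "(n - 1) * (200 * n + 15) + 12 \<le> 300 * n\<^sup>2"
        using n by (cases n) (simp_all add: power2_eq_square algebra_simps)
      then show "(n - 1) * (200 * n + acost (Sub (var ''n'') (Const 1)) + 11) +
          acost (Sub (var ''n'') (Const 1)) + 8 \<le> 300 * n\<^sup>2" by (simp add: ac_simps)
    qed (rule step)
  next
    have "n \<le> n\<^sup>2" "1 \<le> n\<^sup>2" using n by (simp_all add: power2_eq_square)
    then show "1 + 60 * n + 300 * n\<^sup>2 \<le> 400 * n\<^sup>2" by linarith
  qed
qed

section \<open>Computing the threshold\<close>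

definition count_prog :: com where
  "count_prog = For ''j'' (var ''n'')
     (Cond (Less (Read ''key'' (var ''i'')) (Read ''key'' (var ''j'')))
       (assign ''cnt'' (Add (var ''cnt'') (Const 1))) Skip)"

lemma card_Collect_less_Suc:
  "card {j. j < Suc i \<and> Q j} = (if Q i then Suc (card {j. j < i \<and> Q j}) else card {j. j < i \<and> Q j})"
proof -
  have "{j. j < Suc i \<and> Q j} = (if Q i then insert i {j. j < i \<and> Q j} else {j. j < i \<and> Q j})"
    by (auto simp: less_Suc_eq)
  then show ?thesis by simp
qed

lemma runs_count:
  assumes "s ''n'' 0 = n" and "s ''cnt'' 0 = 0" and "0 < n"
  shows "runs count_prog (50 * n) s (\<lambda>s'.
    s' ''cnt'' 0 = card {j. j < n \<and> s ''key'' (s ''i'' 0) < s ''key'' j} \<and>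
    (\<forall>x. x \<notin> {''j'', ''cnt''} \<longrightarrow> s' x = s x))"
  unfolding count_prog_def
  by (rule runs_For_loop_free[where N = n and I = "\<lambda>i s'. s' ''j'' 0 = i \<and>
    s' ''cnt'' 0 = card {j. j < i \<and> s ''key'' (s ''i'' 0) < s ''key'' j} \<and>
    (\<forall>x. x \<notin> {''j'', ''cnt''} \<longrightarrow> s' x = s x)"])
    (use assms in \<open>simp_all add: card_Collect_less_Suc\<close>)

text \<open>By \<open>card_components_light\<close>, the count for \<open>key i\<close> is one less
  than the number of components at that threshold. Testing all \<open>n\<close> keys by a linear
  count each stays quadratic without sorting.\<close>

definition threshold_prog :: com where
  "threshold_prog = Seq (assign ''thr'' (var ''bound''))
     (For ''i'' (var ''n'') (Seq (assign ''cnt'' (Const 0)) (Seq count_prog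
       (Cond (Conj (Neg (Less (var ''k'') (var ''cnt'')))
           (Less (Read ''key'' (var ''i'')) (var ''thr'')))
         (assign ''thr'' (Read ''key'' (var ''i''))) Skip))))"

lemma runs_threshold:
  fixes s :: state
  assumes n: "s ''n'' 0 = n" "0 < n"
  defines "N \<equiv> \<lambda>i. card {j. j < n \<and> s ''key'' i < s ''key'' j}"
  shows "runs threshold_prog (150 * n\<^sup>2) s (\<lambda>s'.
    (\<forall>i<n. N i \<le> s ''k'' 0 \<longrightarrow> s' ''thr'' 0 \<le> s ''key'' i) \<and>
    (s' ''thr'' 0 = s ''bound'' 0 \<or> (\<exists>i<n. s' ''thr'' 0 = s ''key'' i \<and> N i \<le> s ''k'' 0)) \<and>
    (\<forall>x. x \<notin> {''i'', ''j'', ''cnt'', ''thr''} \<longrightarrow> s' x = s x))"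
proof -
  define frame where "frame s' \<longleftrightarrow>
    (\<forall>x. x \<notin> {''i'', ''j'', ''cnt'', ''thr''} \<longrightarrow> s' x = s x)" for s' :: state
  \<comment> \<open>The current threshold is the least among \<open>bound\<close> and the qualifying
    keys scanned so far.\<close>
  define opt where "opt i t \<longleftrightarrow> (\<forall>a<i. N a \<le> s ''k'' 0 \<longrightarrow> t \<le> s ''key'' a) \<and>
    (t = s ''bound'' 0 \<or> (\<exists>a<n. t = s ''key'' a \<and> N a \<le> s ''k'' 0))" for i t
  have opt_step: "(N i \<le> s ''k'' 0 \<and> s ''key'' i < t \<longrightarrow> opt (Suc i) (s ''key'' i)) \<and>
      ((N i \<le> s ''k'' 0 \<longrightarrow> t \<le> s ''key'' i) \<longrightarrow> opt (Suc i) t)"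
    if "opt i t" "i < n" for i t
    using that unfolding opt_def by (auto simp: less_Suc_eq)
  let ?upd = "Cond (Conj (Neg (Less (var ''k'') (var ''cnt'')))
      (Less (Read ''key'' (var ''i'')) (var ''thr'')))
    (assign ''thr'' (Read ''key'' (var ''i''))) Skip"
  define I where "I i s' \<longleftrightarrow> s' ''i'' 0 = i \<and> opt i (s' ''thr'' 0) \<and> frame s'" for i and s' :: state
  have body: "runs (Seq (assign ''cnt'' (Const 0)) (Seq count_prog ?upd)) (100 * n) s1
      (\<lambda>s'. I (Suc i) (s'(''i'' := (s' ''i'')(0 := Suc (s' ''i'' 0)))))"
    if i: "i < n" and I: "I i s1" for i s1
  proof (rule runs_Seq)
    let ?s2 = "s1(''cnt'' := (s1 ''cnt'')(0 := 0))"
    show "runs (assign ''cnt'' (Const 0)) 3 s1 (\<lambda>s'. s' = ?s2)" by (rule runs_loop_free) auto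
    fix s2 assume s2: "s2 = ?s2"
    have frame2: "frame s2" and i2: "s2 ''i'' 0 = i" and thr2: "s2 ''thr'' 0 = s1 ''thr'' 0"
      and n2: "s2 ''n'' 0 = n" and key2: "s2 ''key'' = s ''key''"
      using I n unfolding I_def frame_def s2 by simp_all
    show "runs (Seq count_prog ?upd) (90 * n) s2
      (\<lambda>s'. I (Suc i) (s'(''i'' := (s' ''i'')(0 := Suc (s' ''i'' 0)))))"
    proof (rule runs_Seq[OF runs_count[where n = n]])
      show "s2 ''n'' 0 = n" "s2 ''cnt'' 0 = 0" "0 < n" using n2 n s2 by auto
      fix s3 :: state
      assume s3: "s3 ''cnt'' 0 = card {j. j < n \<and> s2 ''key'' (s2 ''i'' 0) < s2 ''key'' j} \<and>
        (\<forall>x. x \<notin> {''j'', ''cnt''} \<longrightarrow> s3 x = s2 x)"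
      then have cnt3: "s3 ''cnt'' 0 = N i" unfolding N_def key2 i2 by simp
      have frame3: "frame s3" and i3: "s3 ''i'' 0 = i" and thr3: "s3 ''thr'' 0 = s1 ''thr'' 0"
        and key3: "s3 ''key'' = s ''key''" and k3: "s3 ''k'' = s ''k''"
        using s3 frame2 i2 thr2 key2 unfolding frame_def by simp_all
      show "runs ?upd 30 s3 (\<lambda>s'. I (Suc i) (s'(''i'' := (s' ''i'')(0 := Suc (s' ''i'' 0)))))"
        using opt_step[of i "s1 ''thr'' 0"] I i frame3 i3 thr3 cnt3 key3 k3
        by (intro runs_loop_free) (simp_all add: I_def frame_def not_less)
    qed (use n in simp)
  qed (use n in simp)
  have "runs threshold_prog (150 * n\<^sup>2) s (I n)"
    unfolding threshold_prog_def
  proof (rule runs_Seq)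
    let ?s1 = "s(''thr'' := (s ''thr'')(0 := s ''bound'' 0))"
    show "runs (assign ''thr'' (var ''bound'')) 4 s (\<lambda>s'. s' = ?s1)" by (rule runs_loop_free) auto
    fix s1 assume s1: "s1 = ?s1"
    show "runs (For ''i'' (var ''n'') (Seq (assign ''cnt'' (Const 0)) (Seq count_prog ?upd)))
        (140 * n\<^sup>2) s1 (I n)"
    proof (rule runs_For[where I = I and N = n and T = "100 * n"])
      show "I 0 (s1(''i'' := (s1 ''i'')(0 := 0)))"
        unfolding I_def frame_def opt_def s1 by simp
      show "s' ''i'' 0 = i \<and> aval (var ''n'') s' = n" if "I i s'" for i s'
        using that n unfolding I_def frame_def by simp
      have "n * (100 * n + acost (var ''n'') + 11) + acost (var ''n'') + 8 = 100 * n\<^sup>2 + 13 * n + 10"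
        by (simp add: algebra_simps power2_eq_square)
      moreover have "n \<le> n\<^sup>2" "1 \<le> n\<^sup>2" using n by (simp_all add: power2_eq_square)
      ultimately show "n * (100 * n + acost (var ''n'') + 11) + acost (var ''n'') + 8 \<le> 140 * n\<^sup>2"
        by linarith
    qed (use body in auto)
  next
    have "1 \<le> n\<^sup>2" using n by simp
    then show "1 + 4 + 140 * n\<^sup>2 \<le> 150 * n\<^sup>2" by linarith
  qed
  then show ?thesis
    unfolding I_def opt_def frame_def by (rule runs_weaken) simp_all
qed

section \<open>Output of the new edges\<close>

definition output_prog :: com where
  "output_prog = Seq
     (For ''j'' (var ''n'')
       (Cond (Conj (Less (Const 0) (Read ''key'' (var ''j'')))
           (Equal (Read ''adj'' (Add (Read ''row'' (var ''j'')) (Read ''par'' (var ''j'')))) (Const 0)))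
         (Seq (Write ''src'' (var ''len'') (var ''j''))
           (Seq (Write ''tgt'' (var ''len'') (Read ''par'' (var ''j'')))
             (assign ''len'' (Add (var ''len'') (Const 1)))))
         Skip))
     (Cond (Less (var ''k'') (var ''len'')) (assign ''len'' (Const 0)) Skip)"

lemma output_edges_snoc:
  assumes "s' ''len'' 0 = Suc l" and "s ''len'' 0 = l"
    and "s' ''src'' = (s ''src'')(l := a)" and "s' ''tgt'' = (s ''tgt'')(l := b)"
  shows "output_edges s' = insert {a, b} (output_edges s)"
proof -
  have "output_edges s' = (\<lambda>i. {s' ''src'' i, s' ''tgt'' i}) ` {..<Suc l}"
    using assms(1) unfolding output_edges_def by auto
  also have "\<dots> = insert {a, b} ((\<lambda>i. {s ''src'' i, s ''tgt'' i}) ` {..<l})"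
    unfolding lessThan_Suc using assms(3,4) by simp
  also have "(\<lambda>i. {s ''src'' i, s ''tgt'' i}) ` {..<l} = output_edges s"
    using assms(2) unfolding output_edges_def by auto
  finally show ?thesis .
qed

lemma output_edges_cong:
  "s' ''len'' 0 = s ''len'' 0 \<Longrightarrow> s' ''src'' = s ''src'' \<Longrightarrow> s' ''tgt'' = s ''tgt'' \<Longrightarrow>
    output_edges s' = output_edges s"
  unfolding output_edges_def by simp

text \<open>More than \<open>k\<close> edges arise only if no set of at most \<open>k\<close> new
  edges gives a finite diameter. Then the empty set is output, which respects the budget and is as
  good as any other.\<close>

lemma runs_output:
  fixes s :: state
  assumes s: "s ''n'' 0 = n" "s ''len'' 0 = 0" "0 < n"
  defines "Q \<equiv> \<lambda>j. 0 < s ''key'' j \<and> s ''adj'' (s ''row'' j + s ''par'' j) = 0"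
  defines "J \<equiv> {j. j < n \<and> Q j}"
  shows "runs output_prog (100 * n) s (\<lambda>s'. output_edges s' =
    (if card J \<le> s ''k'' 0 then (\<lambda>j. {j, s ''par'' j}) ` J else {}))"
  unfolding output_prog_def
proof (rule runs_Seq[where T' = 15])
  let ?body = "Cond (Conj (Less (Const 0) (Read ''key'' (var ''j'')))
           (Equal (Read ''adj'' (Add (Read ''row'' (var ''j'')) (Read ''par'' (var ''j'')))) (Const 0)))
         (Seq (Write ''src'' (var ''len'') (var ''j''))
           (Seq (Write ''tgt'' (var ''len'') (Read ''par'' (var ''j'')))
             (assign ''len'' (Add (var ''len'') (Const 1)))))
         Skip"
  define I where "I i s' \<longleftrightarrow> s' ''j'' 0 = i \<and> s' ''len'' 0 = card {j. j < i \<and> Q j} \<and>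
    output_edges s' = (\<lambda>j. {j, s ''par'' j}) ` {j. j < i \<and> Q j} \<and>
    (\<forall>x. x \<notin> {''j'', ''src'', ''tgt'', ''len''} \<longrightarrow> s' x = s x)" for i and s' :: state
  show "runs (For ''j'' (var ''n'') ?body) (80 * n) s (I n)"
  proof (rule runs_For_loop_free[where N = n and I = I])
    show "I 0 (s(''j'' := (s ''j'')(0 := 0)))"
      using s unfolding I_def output_edges_def by simp
    fix i and s1 :: state
    assume I: "I i s1"
    then show "s1 ''j'' 0 = i \<and> aval (var ''n'') s1 = n" using s unfolding I_def by simp
    let ?s2 = "(result ?body s1)(''j'' := (result ?body s1 ''j'')(0 := Suc (result ?body s1 ''j'' 0)))"
    have bval: "bval (Conj (Less (Const 0) (Read ''key'' (var ''j'')))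
        (Equal (Read ''adj'' (Add (Read ''row'' (var ''j'')) (Read ''par'' (var ''j'')))) (Const 0))) s1
      \<longleftrightarrow> Q i"
      using I unfolding I_def Q_def by simp
    show "I (Suc i) ?s2"
    proof (cases "Q i")
      case True
      have "output_edges ?s2 = insert {i, s ''par'' i} (output_edges s1)"
        using True I bval by (intro output_edges_snoc[where l = "s1 ''len'' 0"]) (simp_all add: I_def)
      moreover have "{j. j < Suc i \<and> Q j} = insert i {j. j < i \<and> Q j}"
        using True by (auto simp: less_Suc_eq)
      ultimately show ?thesis
        using True I bval card_Collect_less_Suc[of i Q] by (simp add: I_def)
    next
      case False
      then have unchanged: "result ?body s1 = s1" by (simp only: result.simps bval if_False)
      have "output_edges ?s2 = output_edges s1"
        unfolding unchanged by (rule output_edges_cong) simp_all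
      moreover have "{j. j < Suc i \<and> Q j} = {j. j < i \<and> Q j}"
        using False by (auto simp: less_Suc_eq)
      ultimately show ?thesis
        using I unfolding unchanged by (simp add: I_def)
    qed
  qed (use s in simp_all)
  fix s1 assume I: "I n s1"
  \<comment> \<open>Resetting the length discards the list although its cells keep their
    contents.\<close>
  have "output_edges (s1(''len'' := (s1 ''len'')(0 := 0))) = {}"
    unfolding output_edges_def by simp
  then show "runs (Cond (Less (var ''k'') (var ''len'')) (assign ''len'' (Const 0)) Skip) 15 s1
      (\<lambda>s'. output_edges s' = (if card J \<le> s ''k'' 0 then (\<lambda>j. {j, s ''par'' j}) ` J else {}))"
    using I unfolding I_def J_def by (intro runs_loop_free) auto
qed (use s in simp)


section \<open>Approximation guarantee\<close>

lemma sp_dist_nonneg: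
  assumes "X \<subseteq> [V]\<^bsup>2\<^esup>"
  shows "0 \<le> sp_dist V X w u v"
proof -
  interpret wf_digraph "with_proj (sym_digraph_of V X)"
    using assms by (rule wf_digraph_sym_digraph_of)
  show ?thesis
    unfolding sp_dist_def \<mu>_def
  proof (rule INF_greatest)
    fix p assume "p \<in> {p. awalk u p v}"
    then obtain c where "awalk_cost (\<lambda>(x, y). real (w {x, y})) p = real c"
      using awalk_imp_walk[OF assms] by blast
    then show "0 \<le> ereal (awalk_cost (\<lambda>(x, y). real (w {x, y})) p)" by simp
  qed
qed

lemma sp_dist_le_diameter:
  assumes "u \<in> V" and "v \<in> V"
  shows "sp_dist V X w u v \<le> diameter V X w"
  unfolding diameter_def by (rule SUP_upper2[OF assms(1) SUP_upper[OF assms(2)]])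

text \<open>A vertex is needed because the supremum over no vertices is \<open>-\<infinity>\<close>
  in \<open>ereal\<close>.\<close>

lemma diameter_nonneg:
  assumes "X \<subseteq> [V]\<^bsup>2\<^esup>" and "V \<noteq> {}"
  shows "0 \<le> diameter V X w"
proof -
  obtain v where v: "v \<in> V" using assms(2) by blast
  have "0 \<le> sp_dist V X w v v" using assms(1) by (rule sp_dist_nonneg)
  also have "\<dots> \<le> diameter V X w" using v v by (rule sp_dist_le_diameter)
  finally show ?thesis .
qed

text \<open>There are finitely many candidate sets, and the empty one fits any nonnegative budget,
  so the infimum is a minimum.\<close>

lemma opt_diameter_attained:
  assumes "finite V" and "0 \<le> B"
  shows "\<exists>F\<subseteq>non_edges V E. int (\<Sum>e\<in>F. c e) \<le> B \<and> diameter V (E \<union> F) w = opt_diameter V E w c B"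
proof -
  let ?S = "{F. F \<subseteq> non_edges V E \<and> int (\<Sum>e\<in>F. c e) \<le> B}"
  have "finite (non_edges V E)"
    unfolding non_edges_def using finite_imp_finite_nsets[OF assms(1)] by simp
  then have "finite ?S" by (rule rev_finite_subset[OF finite_Pow_iff[THEN iffD2]]) auto
  moreover have "{} \<in> ?S" using assms(2) by simp
  ultimately have "Inf ((\<lambda>F. diameter V (E \<union> F) w) ` ?S) \<in> (\<lambda>F. diameter V (E \<union> F) w) ` ?S"
    by (subst cInf_eq_Min) (auto intro!: Min_in simp del: mem_Collect_eq)
  then show ?thesis unfolding opt_diameter_def by auto
qed

text \<open>Passes from integer distance bounds to the ratio in \<open>ereal\<close>: for a finite
  optimum \<open>r\<close> the hypothesis \<open>dist\<close> is applied with \<open>b\<close> the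
  floor of \<open>r\<close>.\<close>

lemma approx_solution_unit_cost:
  assumes V: "finite V" "V \<noteq> {}" and E: "E \<subseteq> [V]\<^bsup>2\<^esup>"
    and F: "F \<subseteq> non_edges V E" "card F \<le> k"
    and dist: "\<And>F' b u v. F' \<subseteq> non_edges V E \<Longrightarrow> card F' \<le> k \<Longrightarrow>
      (\<And>u v. u \<in> V \<Longrightarrow> v \<in> V \<Longrightarrow> within_dist (E \<union> F') w b u v) \<Longrightarrow> u \<in> V \<Longrightarrow> v \<in> V \<Longrightarrow>
      within_dist (E \<union> F) w (a * b) u v"
    and a: "0 < a"
  shows "approx_solution 1 (real a) V E w (\<lambda>_. 1) (int k) F"
proof -
  obtain F' where F': "F' \<subseteq> non_edges V E" "card F' \<le> k"
    and opt: "diameter V (E \<union> F') w = opt_diameter V E w (\<lambda>_. 1) (int k)"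
    using opt_diameter_attained[OF V(1), of "int k" E "\<lambda>_. 1" w] by auto
  have X: "E \<union> F \<subseteq> [V]\<^bsup>2\<^esup>" "E \<union> F' \<subseteq> [V]\<^bsup>2\<^esup>"
    using E F F' unfolding non_edges_def by auto
  have "diameter V (E \<union> F) w \<le> ereal (real a) * diameter V (E \<union> F') w"
  proof (cases "diameter V (E \<union> F') w")
    case PInf
    \<comment> \<open>As \<open>a\<close> is positive, the right-hand side is infinite too.\<close>
    then show ?thesis using a by simp
  next
    case MInf
    then show ?thesis using diameter_nonneg[OF X(2) V(2), of w] by simp
  next
    case (real r)
    have r: "0 \<le> r" using diameter_nonneg[OF X(2) V(2), of w] real by simp
    have "within_dist (E \<union> F') w (nat \<lfloor>r\<rfloor>) u v" if "u \<in> V" "v \<in> V" for u v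
    proof (rule within_dist_floor[OF X(2)])
      have "sp_dist V (E \<union> F') w u v \<le> diameter V (E \<union> F') w"
        using that by (rule sp_dist_le_diameter)
      then show "sp_dist V (E \<union> F') w u v \<le> ereal r" using real by simp
    qed
    then have "sp_dist V (E \<union> F) w u v \<le> ereal (real (a * nat \<lfloor>r\<rfloor>))" if "u \<in> V" "v \<in> V" for u v
      using that dist[OF F'] by (intro sp_dist_le[OF X(1)]) auto
    then have "diameter V (E \<union> F) w \<le> ereal (real (a * nat \<lfloor>r\<rfloor>))"
      unfolding diameter_def by (intro SUP_least)
    also have "\<dots> \<le> ereal (real a * r)" using r by (simp add: mult_left_mono)
    finally show ?thesis using real by simp
  qed
  then show ?thesis
    unfolding approx_solution_def using F opt by simp
qed

section \<open>Assembly of the program\<close>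

definition diameter_prog :: com where
  "diameter_prog = Seq rows_prog (Seq bound_prog (Seq graph_costs_prog (Seq prim_prog
     (Seq threshold_prog (Seq completion_costs_prog (Seq prim_prog output_prog))))))"

lemma matrix_index:
  fixes u v n :: nat
  assumes "u < n" and "v < n"
  shows "u * n + v < n * n" and "(u * n + v) div n = u" and "(u * n + v) mod n = v"
proof -
  have "u * n + v < Suc u * n" using assms(2) by simp
  also have "\<dots> \<le> n * n" using assms(1) by (intro mult_le_mono1) simp
  finally show "u * n + v < n * n" .
qed (use assms in auto)

text \<open>Each phase is followed by frame facts that carry the input matrices, \<open>k\<close>
  and the row table through to the next. The time bounds are rounded up generously.\<close>

lemma runs_diameter_prog:
  assumes n: "1 \<le> n" and E: "E \<subseteq> [{..<n}]\<^bsup>2\<^esup>"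
  shows "runs diameter_prog (1500 * n\<^sup>2) (initial_state n E w k)
    (\<lambda>s. approx_solution 1 (3 * real k + 2) {..<n} E w (\<lambda>_. 1) (int k) (output_edges s))"
proof -
  define s0 where "s0 = initial_state n E w k"
  have n0: "0 < n" and init: "s0 ''n'' 0 = n" "s0 ''k'' 0 = k" "s0 ''row'' 0 = 0" "s0 ''len'' 0 = 0"
    using n unfolding s0_def initial_state_def by simp_all
  have adj: "s0 ''adj'' (u * n + v) = (if {u, v} \<in> E then 1 else 0)" if "u < n" "v < n" for u v
    using matrix_index[OF that] unfolding s0_def initial_state_def by simp
  have weight: "s0 ''weight'' (u * n + v) = w {u, v}" if "u < n" "v < n" "u \<noteq> v" for u v
    using matrix_index[OF that(1,2)] that(3) unfolding s0_def initial_state_def by simp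
  have "runs diameter_prog (1500 * n\<^sup>2) s0
    (\<lambda>s. approx_solution 1 (3 * real k + 2) {..<n} E w (\<lambda>_. 1) (int k) (output_edges s))"
    unfolding diameter_prog_def
  proof (rule runs_Seq[OF runs_rows[where s = s0 and n = n, OF init(1,3) n0]])
    fix s1 assume s1: "(\<forall>a\<le>n. s1 ''row'' a = a * n) \<and> (\<forall>x. x \<notin> {''i'', ''row''} \<longrightarrow> s1 x = s0 x)"
    then have row1: "\<And>a. a \<le> n \<Longrightarrow> s1 ''row'' a = a * n"
      and frame1: "\<And>x. x \<notin> {''i'', ''row''} \<Longrightarrow> s1 x = s0 x" by blast+
    show "runs (Seq bound_prog (Seq graph_costs_prog (Seq prim_prog (Seq threshold_prog
        (Seq completion_costs_prog (Seq prim_prog output_prog)))))) (1450 * n\<^sup>2) s1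
      (\<lambda>s. approx_solution 1 (3 * real k + 2) {..<n} E w (\<lambda>_. 1) (int k) (output_edges s))"
    proof (rule runs_Seq[OF runs_bound[where s = s1 and n = n, OF _ _ n0]])
      show "s1 ''n'' 0 = n" "s1 ''row'' n = n * n" using frame1 row1 init by simp_all
      fix s2 assume s2: "(\<forall>a<n * n. s2 ''weight'' a < s2 ''bound'' 0) \<and>
        (\<forall>x. x \<notin> {''i'', ''bound''} \<longrightarrow> s2 x = s1 x)"
      define bound where "bound = s2 ''bound'' 0"
      have frame2: "s2 x = s0 x" if "x \<notin> {''i'', ''row'', ''bound''}" for x
        using that s2 frame1 by simp
      have row2: "s2 ''row'' = s1 ''row''" using s2 by simp
      have bound: "w {u, v} < bound" if "u < n" "v < n" "u \<noteq> v" for u v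
        using s2 matrix_index(1)[OF that(1,2)] weight[OF that] frame2[of "''weight''"]
        unfolding bound_def by force
      show "runs (Seq graph_costs_prog (Seq prim_prog (Seq threshold_prog
          (Seq completion_costs_prog (Seq prim_prog output_prog))))) (1400 * n\<^sup>2) s2
        (\<lambda>s. approx_solution 1 (3 * real k + 2) {..<n} E w (\<lambda>_. 1) (int k) (output_edges s))"
      proof (rule runs_Seq[OF runs_graph_costs[where s = s2 and n = n, OF _ _ n0]])
        show "s2 ''n'' 0 = n" "s2 ''row'' n = n * n" using frame2 row2 row1 init by simp_all
        fix s3 assume s3: "(\<forall>a<n * n. s3 ''cost'' a =
            (if s2 ''adj'' a = 1 then s2 ''weight'' a else s2 ''bound'' 0)) \<and>
          (\<forall>x. x \<notin> {''i'', ''cost''} \<longrightarrow> s3 x = s2 x)"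
        have frame3: "s3 x = s0 x" if "x \<notin> {''i'', ''row'', ''bound'', ''cost''}" for x
          using that s3 frame2 by simp
        have row3: "s3 ''row'' = s1 ''row''" and bound3: "s3 ''bound'' 0 = bound"
          using s3 row2 unfolding bound_def by simp_all
        define C1 where "C1 u v = s3 ''cost'' (u * n + v)" for u v
        have C1: "C1 u v = (if {u, v} \<in> E then w {u, v} else bound)"
          if "u < n" "v < n" "u \<noteq> v" for u v
          using s3 matrix_index(1)[OF that(1,2)] weight[OF that] adj[OF that(1,2)]
            frame2[of "''weight''"] frame2[of "''adj''"]
          unfolding C1_def bound_def by simp
        show "runs (Seq prim_prog (Seq threshold_prog
            (Seq completion_costs_prog (Seq prim_prog output_prog)))) (1350 * n\<^sup>2) s3
          (\<lambda>s. approx_solution 1 (3 * real k + 2) {..<n} E w (\<lambda>_. 1) (int k) (output_edges s))"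
        proof (rule runs_Seq[OF runs_prim[where s = s3 and n = n, OF _ _ n0]])
          show "s3 ''n'' 0 = n" "\<And>a. a < n \<Longrightarrow> s3 ''row'' a = a * n"
            using frame3 row3 row1 init by simp_all
          show "s3 ''cost'' (u * n + v) = s3 ''cost'' (v * n + u)"
            if "u < n" "v < n" "u \<noteq> v" for u v
            using C1[of u v] C1[of v u] that unfolding C1_def by (simp add: insert_commute)
          fix s4 assume s4: "prim_tree n (\<lambda>u v. s3 ''cost'' (u * n + v)) {..<n}
              (s4 ''key'') (s4 ''par'') \<and>
            (\<forall>x. x \<notin> {''j'', ''q'', ''u'', ''key'', ''par'', ''vis''} \<longrightarrow> s4 x = s3 x)"
          define key1 where "key1 = s4 ''key''"
          have tree1: "prim_tree n C1 {..<n} key1 (s4 ''par'')"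
            using s4 unfolding C1_def key1_def by simp
          have row4: "s4 ''row'' = s1 ''row''" and bound4: "s4 ''bound'' 0 = bound"
            and n4: "s4 ''n'' 0 = n" and k4: "s4 ''k'' 0 = k" and len4: "s4 ''len'' 0 = 0"
            and adj4: "s4 ''adj'' = s0 ''adj''" and weight4: "s4 ''weight'' = s0 ''weight''"
            using s4 row3 bound3 frame3 init by simp_all
          show "runs (Seq threshold_prog (Seq completion_costs_prog (Seq prim_prog output_prog)))
              (900 * n\<^sup>2) s4
            (\<lambda>s. approx_solution 1 (3 * real k + 2) {..<n} E w (\<lambda>_. 1) (int k) (output_edges s))"
          proof (rule runs_Seq[OF runs_threshold[where s = s4 and n = n, OF n4 n0]])
            fix s5 assume s5: "(\<forall>i<n. card {j. j < n \<and> s4 ''key'' i < s4 ''key'' j} \<le> s4 ''k'' 0 \<longrightarrow>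
                s5 ''thr'' 0 \<le> s4 ''key'' i) \<and>
              (s5 ''thr'' 0 = s4 ''bound'' 0 \<or> (\<exists>i<n. s5 ''thr'' 0 = s4 ''key'' i \<and>
                card {j. j < n \<and> s4 ''key'' i < s4 ''key'' j} \<le> s4 ''k'' 0)) \<and>
              (\<forall>x. x \<notin> {''i'', ''j'', ''cnt'', ''thr''} \<longrightarrow> s5 x = s4 x)"
            define thr where "thr = s5 ''thr'' 0"
            have thr_le: "thr \<le> key1 i"
              if "i < n" "card {j. j < n \<and> key1 i < key1 j} \<le> k" for i
              using s5 that unfolding thr_def key1_def k4 by simp
            have thr_cases: "thr = bound \<or>
              (\<exists>i<n. thr = key1 i \<and> card {j. j < n \<and> key1 i < key1 j} \<le> k)"
              using s5 unfolding thr_def key1_def k4 bound4 by simp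
            have row5: "s5 ''row'' = s1 ''row''"
              and n5: "s5 ''n'' 0 = n" and k5: "s5 ''k'' 0 = k" and len5: "s5 ''len'' 0 = 0"
              and adj5: "s5 ''adj'' = s0 ''adj''" and weight5: "s5 ''weight'' = s0 ''weight''"
              using s5 row4 n4 k4 len4 adj4 weight4 by simp_all
            show "runs (Seq completion_costs_prog (Seq prim_prog output_prog)) (700 * n\<^sup>2) s5
              (\<lambda>s. approx_solution 1 (3 * real k + 2) {..<n} E w (\<lambda>_. 1) (int k) (output_edges s))"
            proof (rule runs_Seq[OF runs_completion_costs[where s = s5 and n = n, OF n5 _ n0]])
              show "s5 ''row'' n = n * n" using row5 row1 by simp
              fix s6 assume s6: "(\<forall>a<n * n. s6 ''cost'' a =
                  (if s5 ''adj'' a = 1 \<and> s5 ''weight'' a \<le> s5 ''thr'' 0 then 0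
                   else Suc (s5 ''weight'' a))) \<and>
                (\<forall>x. x \<notin> {''i'', ''cost''} \<longrightarrow> s6 x = s5 x)"
              define C2 where "C2 u v = s6 ''cost'' (u * n + v)" for u v
              have C2: "C2 u v = (if {u, v} \<in> E \<and> w {u, v} \<le> thr then 0 else Suc (w {u, v}))"
                if "u < n" "v < n" "u \<noteq> v" for u v
                using s6 matrix_index(1)[OF that(1,2)] weight[OF that] adj[OF that(1,2)]
                unfolding C2_def thr_def adj5 weight5 by simp
              have row6: "s6 ''row'' = s1 ''row''"
                and n6: "s6 ''n'' 0 = n" and k6: "s6 ''k'' 0 = k" and len6: "s6 ''len'' 0 = 0"
                and adj6: "s6 ''adj'' = s0 ''adj''"
                using s6 row5 n5 k5 len5 adj5 by simp_all
              show "runs (Seq prim_prog output_prog) (600 * n\<^sup>2) s6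
                (\<lambda>s. approx_solution 1 (3 * real k + 2) {..<n} E w (\<lambda>_. 1) (int k) (output_edges s))"
              proof (rule runs_Seq[OF runs_prim[where s = s6 and n = n, OF n6 _ n0]])
                show "\<And>a. a < n \<Longrightarrow> s6 ''row'' a = a * n" using row6 row1 by simp
                show "s6 ''cost'' (u * n + v) = s6 ''cost'' (v * n + u)"
                  if "u < n" "v < n" "u \<noteq> v" for u v
                  using C2[of u v] C2[of v u] that unfolding C2_def by (simp add: insert_commute)
                fix s7 assume s7: "prim_tree n (\<lambda>u v. s6 ''cost'' (u * n + v)) {..<n}
                    (s7 ''key'') (s7 ''par'') \<and>
                  (\<forall>x. x \<notin> {''j'', ''q'', ''u'', ''key'', ''par'', ''vis''} \<longrightarrow> s7 x = s6 x)"
                define key2 par2 where "key2 = s7 ''key''" and "par2 = s7 ''par''"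
                have tree2: "prim_tree n C2 {..<n} key2 par2"
                  using s7 unfolding C2_def key2_def par2_def by simp
                have row7: "s7 ''row'' = s1 ''row''"
                  and n7: "s7 ''n'' 0 = n" and k7: "s7 ''k'' 0 = k" and len7: "s7 ''len'' 0 = 0"
                  and adj7: "s7 ''adj'' = s0 ''adj''"
                  using s7 row6 n6 k6 len6 adj6 by simp_all
                define J where "J = {j. j < n \<and> 0 < key2 j \<and> {j, par2 j} \<notin> E}"
                have parent: "par2 j < n \<and> par2 j \<noteq> j" if "j < n" "0 < key2 j" for j
                  using tree2 that unfolding prim_tree_def by (metis gr0I lessThan_iff less_irrefl)
                have J: "{j. j < n \<and> 0 < s7 ''key'' j \<and> s7 ''adj'' (s7 ''row'' j + s7 ''par'' j) = 0} = J"
                  unfolding J_def adj7 row7 key2_def[symmetric] par2_def[symmetric]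
                  using adj parent row1 by (auto split: if_splits)
                \<comment> \<open>Feasibility of \<open>?F\<close> holds in both cases; that the
                  first case applies is known only when some admissible \<open>F'\<close> yields
                  finite distances.\<close>
                let ?F = "if card J \<le> k then (\<lambda>j. {j, par2 j}) ` J else {}"
                have "finite J" unfolding J_def by simp
                then have "card ?F \<le> k"
                  using card_image_le[of J "\<lambda>j. {j, par2 j}"] by auto
                moreover have "{j, par2 j} \<in> non_edges {..<n} E" if "j \<in> J" for j
                  using parent[of j] that unfolding J_def non_edges_def by simp
                then have "?F \<subseteq> non_edges {..<n} E" by auto
                moreover have "within_dist (E \<union> ?F) w ((3 * k + 2) * b) u v"
                  if F': "F' \<subseteq> non_edges {..<n} E" "card F' \<le> k"
                    and opt: "\<And>u v. u \<in> {..<n} \<Longrightarrow> v \<in> {..<n} \<Longrightarrow> within_dist (E \<union> F') w b u v"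
                    and uv: "u \<in> {..<n}" "v \<in> {..<n}" for F' b u v
                proof -
                  note solution = tree_solution[OF n0 E F' opt bound tree1 C1 thr_le thr_cases tree2 C2]
                  have "card J \<le> k" unfolding J_def by (rule solution) simp_all
                  moreover have "within_dist (E \<union> (\<lambda>j. {j, par2 j}) ` J) w ((3 * k + 2) * b) u v"
                    unfolding J_def by (rule solution) (use uv in simp_all)
                  ultimately show ?thesis by simp
                qed
                ultimately have approx:
                  "approx_solution 1 (real (3 * k + 2)) {..<n} E w (\<lambda>_. 1) (int k) ?F"
                  using n0 E by (intro approx_solution_unit_cost) auto
                have "real (3 * k + 2) = 3 * real k + 2" by simp
                note approx = approx[unfolded this par2_def]
                show "runs output_prog (100 * n\<^sup>2) s7 (\<lambda>s. approx_solution 1 (3 * real k + 2)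
                  {..<n} E w (\<lambda>_. 1) (int k) (output_edges s))"
                proof (rule runs_weaken[OF runs_output[where s = s7 and n = n, OF n7 len7 n0, unfolded J k7]])
                  show "100 * n \<le> 100 * n\<^sup>2" using n0 by (simp add: power2_eq_square)
                qed (simp only: approx)
              qed (use n0 in simp)
            qed (use n0 in simp)
          qed (use n0 in simp)
        qed (use n0 in simp)
      qed (use n0 in simp)
    qed (use n0 in simp)
  qed (use n0 in simp)
  then show ?thesis unfolding s0_def .
qed

theorem theorem5:
  shows "\<exists>(P :: com) (C :: nat). \<forall>(n :: nat) (k :: nat) (E :: nat set set) (w :: nat set \<Rightarrow> nat).
    1 \<le> n \<longrightarrow> E \<subseteq> [{..<n}]\<^bsup>2\<^esup> \<longrightarrow>
    (\<exists>t s. exec P (initial_state n E w k) t s \<and>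
       t \<le> C * (n ^ 2 + k ^ 2) \<and>
       approx_solution 1 (3 * real k + 2) {..<n} E w (\<lambda>_. 1) (int k) (output_edges s))"
\<comment> \<open>The budget is only compared with, never iterated over, so
  \<open>1500 * n\<^sup>2\<close> steps already suffice.\<close>
proof (rule exI[of _ diameter_prog], rule exI[of _ 1500], intro allI impI)
  fix n k :: nat and E :: "nat set set" and w :: "nat set \<Rightarrow> nat"
  assume "1 \<le> n" and "E \<subseteq> [{..<n}]\<^bsup>2\<^esup>"
  then have "runs diameter_prog (1500 * (n ^ 2 + k ^ 2)) (initial_state n E w k)
    (\<lambda>s. approx_solution 1 (3 * real k + 2) {..<n} E w (\<lambda>_. 1) (int k) (output_edges s))"
    by (intro runs_weaken[OF runs_diameter_prog]) auto
  then show "\<exists>t s. exec diameter_prog (initial_state n E w k) t s \<and> t \<le> 1500 * (n ^ 2 + k ^ 2) \<and>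
      approx_solution 1 (3 * real k + 2) {..<n} E w (\<lambda>_. 1) (int k) (output_edges s)"
    unfolding runs_def .
qed

end
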